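(* Let $n,m\ge1$ be integers, $\mathbf P=B_{n,m}$ the bipath poset, $\zeta\colon Z\to\mathbf P$ the order-preserving map defined in the context, and $R\colon\operatorname{mod}\Bbbk[\mathbf P]\to\operatorname{mod}\Bbbk[Z]$, $M\mapsto M\circ\Bbbk[\zeta]$, the restriction functor induced by $\zeta$. Then for every interval $I\in\mathbb I_{\mathrm d}\sqcup\mathbb I_{\mathrm u}\sqcup\mathbb I_{\mathrm r}\sqcup\{B_{n,m}\}$ and every $M\in\operatorname{mod}\Bbbk[\mathbf P]$, $$d_M(V_I)=\bar d_{R(M)}(R(V_I))=d_{R(M)}(R(V_I)).$$
   Context: $\Bbbk$ is a field. For a finite poset $S$, $\Bbbk[S]$ is the $\Bbbk$-linearization of $S$ viewed as a category and $\operatorname{mod}\Bbbk[S]$ is the category of $\Bbbk$-linear functors from $\Bbbk[S]$ to finite-dimensional vector spaces. For an interval $I$ (nonempty connected convex full subposet), $V_I$ is the module with $V_I(x)=\Bbbk$ for $x\in I$, $0$ otherwise, identity structure maps inside $I$, zero otherwise. For an indecomposable module $L$, $d_N(L)$ is its multiplicity in a decomposition of $N$ into indecomposables; for a general module $L$, if $N\cong L^r\oplus N'$ with $N'$ having no direct summand isomorphic to $L$, then $\bar d_N(L):=r$. The bipath poset $B_{n,m}$ has elements $\hat0,\hat1,1,\dots,n,1',\dots,m'$ and order generated by $\hat0<1<2<\cdots<n<\hat1$ and $\hat0<1'<2'<\cdots<m'<\hat1$. $\mathbb I_{\mathrm u}$ is the set of intervals $[s,t]=\{x\mid s\le x\le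 t\}$ with $s\le t$ in $\{1,\dots,n\}$; $\mathbb I_{\mathrm d}$ is the set of intervals $[s',t']$ with $s'\le t'$ in $\{1',\dots,m'\}$; $\mathbb I_{\mathrm r}$ is the set of intervals $[s,\hat1]\cup[s',\hat1]$ with $s\in\{1,\dots,n,\hat1\}$ and $s'\in\{1',\dots,m',\hat1\}$. $Z$ is the poset with elements $\bar0,\hat0,\hat1,1,\dots,n,1',\dots,m'$ and order generated by $\bar0<1<2<\cdots<n<\hat1$ and $\hat0<1'<2'<\cdots<m'<\hat1$ (so $\bar0$ and $\hat0$ are incomparable). $\zeta\colon Z\to B_{n,m}$ is given by $\zeta(x)=x$ for $x\ne\bar0$ and $\zeta(\bar0)=\hat0$; $\Bbbk[\zeta]\colon\Bbbk[Z]\to\Bbbk[B_{n,m}]$ is the induced linear functor. *)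

theory Defs
  imports Complex_Main "HOL-Library.Function_Algebras" "HOL-Library.Product_Plus"
begin

section \<open>Modules over the linearization of a finite poset\<close>

text \<open>
  A finite poset is given by its order relation \<open>r\<close> (a reflexive relation, so that its set of
  elements is \<open>Field r\<close>). In the linearization \<open>k[S]\<close> of a thin category, the hom space from \<open>x\<close> to
  \<open>y\<close> is free on at most one generator; the scalar \<open>c\<close> below stands for \<open>c\<close> times the unique
  arrow from \<open>x\<close> to \<open>y\<close>, and composition is multiplication of scalars.
\<close>

definition lin_hom :: "'p rel \<Rightarrow> 'p \<Rightarrow> 'p \<Rightarrow> 'k::field set" where
  "lin_hom r x y = {c. (x, y) \<in> r \<or> c = 0}"

text \<open>
  Functors from \<open>k[S]\<close> to finite-dimensional vector spaces. The vector spaces \<open>obj M x\<close> are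
  subspaces of one ambient space, namely the type \<open>'v\<close> with scalar multiplication \<open>smul M\<close>; this is
  no restriction since \<open>'v\<close> is arbitrary (e.g. it may be the direct sum of given spaces).
  Only values at elements of \<open>Field r\<close>, at scalars in \<open>lin_hom r x y\<close>, and at vectors of
  \<open>obj M x\<close> matter, and all notions below ignore the other ones.
\<close>

record ('p, 'k, 'v) kfunctor =
  smul :: "'k \<Rightarrow> 'v \<Rightarrow> 'v"
  obj :: "'p \<Rightarrow> 'v set"
  mor :: "'p \<Rightarrow> 'p \<Rightarrow> 'k \<Rightarrow> 'v \<Rightarrow> 'v"

definition linear_between ::
  "('k \<Rightarrow> 'v::ab_group_add \<Rightarrow> 'v) \<Rightarrow> ('k \<Rightarrow> 'w::ab_group_add \<Rightarrow> 'w) \<Rightarrow> 'v set \<Rightarrow> 'w set \<Rightarrow> ('v \<Rightarrow> 'w) \<Rightarrow> bool"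
where
  "linear_between s t V W f \<longleftrightarrow>
     (\<forall>v\<in>V. f v \<in> W) \<and>
     (\<forall>u\<in>V. \<forall>v\<in>V. f (u + v) = f u + f v) \<and>
     (\<forall>a. \<forall>v\<in>V. f (s a v) = t a (f v))"

definition kmodule :: "'p rel \<Rightarrow> ('p, 'k::field, 'v::ab_group_add) kfunctor \<Rightarrow> bool" where
  "kmodule r M \<longleftrightarrow>
     vector_space (smul M) \<and>
     (\<forall>x\<in>Field r. module.subspace (smul M) (obj M x) \<and>
        (\<exists>B. finite B \<and> obj M x = module.span (smul M) B)) \<and>
     (\<forall>x\<in>Field r. \<forall>y\<in>Field r. \<forall>c\<in>lin_hom r x y.
        linear_between (smul M) (smul M) (obj M x) (obj M y) (mor M x y c)) \<and>
     (\<forall>x\<in>Field r. \<forall>v\<in>obj M x. mor M x x 1 v = v) \<and>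
     (\<forall>x\<in>Field r. \<forall>y\<in>Field r. \<forall>z\<in>Field r. \<forall>c\<in>lin_hom r x y. \<forall>d\<in>lin_hom r y z. \<forall>v\<in>obj M x.
        mor M x z (d * c) v = mor M y z d (mor M x y c v)) \<and>
     (\<forall>x\<in>Field r. \<forall>y\<in>Field r. \<forall>c\<in>lin_hom r x y. \<forall>d\<in>lin_hom r x y. \<forall>a. \<forall>v\<in>obj M x.
        mor M x y (c + d) v = mor M x y c v + mor M x y d v \<and>
        mor M x y (a * c) v = smul M a (mor M x y c v))"

definition nat_trans ::
  "'p rel \<Rightarrow> ('p, 'k::field, 'v::ab_group_add) kfunctor \<Rightarrow> ('p, 'k, 'w::ab_group_add) kfunctor
    \<Rightarrow> ('p \<Rightarrow> 'v \<Rightarrow> 'w) \<Rightarrow> bool"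
where
  "nat_trans r M N \<phi> \<longleftrightarrow>
     (\<forall>x\<in>Field r. linear_between (smul M) (smul N) (obj M x) (obj N x) (\<phi> x)) \<and>
     (\<forall>x\<in>Field r. \<forall>y\<in>Field r. \<forall>c\<in>lin_hom r x y. \<forall>v\<in>obj M x.
        \<phi> y (mor M x y c v) = mor N x y c (\<phi> x v))"

definition isomorphic ::
  "'p rel \<Rightarrow> ('p, 'k::field, 'v::ab_group_add) kfunctor \<Rightarrow> ('p, 'k, 'w::ab_group_add) kfunctor \<Rightarrow> bool"
where
  "isomorphic r M N \<longleftrightarrow>
     (\<exists>\<phi> \<psi>. nat_trans r M N \<phi> \<and> nat_trans r N M \<psi> \<and>
        (\<forall>x\<in>Field r. (\<forall>v\<in>obj M x. \<psi> x (\<phi> x v) = v) \<and> (\<forall>w\<in>obj N x. \<phi> x (\<psi> x w) = w)))"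

section \<open>Direct sums and multiplicities\<close>

definition dsum2 ::
  "('p, 'k, 'v) kfunctor \<Rightarrow> ('p, 'k, 'w) kfunctor \<Rightarrow> ('p, 'k, 'v \<times> 'w) kfunctor"
where
  "dsum2 M N =
     \<lparr>smul = (\<lambda>a (v, w). (smul M a v, smul N a w)),
      obj = (\<lambda>x. obj M x \<times> obj N x),
      mor = (\<lambda>x y c (v, w). (mor M x y c v, mor N x y c w))\<rparr>"

text \<open>
  The direct sum of \<open>L 0, \<dots>, L (n - 1)\<close>; its elements are families indexed by all naturals that
  vanish from index \<open>n\<close> on. The scalar multiplication at these indices is therefore irrelevant; the
  choice made only serves to turn the ambient type into a vector space.
\<close>

definition dsum :: "nat \<Rightarrow> (nat \<Rightarrow> ('p, 'k, 'v::zero) kfunctor) \<Rightarrow> ('p, 'k, nat \<Rightarrow> 'v) kfunctor" where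
  "dsum n L =
     \<lparr>smul = (\<lambda>a f i. if i < n then smul (L i) a (f i) else smul (L 0) a (f i)),
      obj = (\<lambda>x. {f. (\<forall>i<n. f i \<in> obj (L i) x) \<and> (\<forall>i\<ge>n. f i = 0)}),
      mor = (\<lambda>x y c f i. if i < n then mor (L i) x y c (f i) else 0)\<rparr>"

text \<open>
  Up to isomorphism, a direct summand of \<open>N\<close> is a submodule of \<open>N\<close>; so below, summands of \<open>N\<close> can be
  taken with the same ambient type as \<open>N\<close> without loss of generality.
\<close>

definition zero_module :: "'p rel \<Rightarrow> ('p, 'k, 'v::zero) kfunctor \<Rightarrow> bool" where
  "zero_module r M \<longleftrightarrow> (\<forall>x\<in>Field r. obj M x = {0})"

definition indecomposable :: "'p rel \<Rightarrow> ('p, 'k::field, 'v::ab_group_add) kfunctor \<Rightarrow> bool" where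
  "indecomposable r L \<longleftrightarrow>
     kmodule r L \<and> \<not> zero_module r L \<and>
     (\<forall>(A :: ('p, 'k, 'v) kfunctor) (B :: ('p, 'k, 'v) kfunctor).
        kmodule r A \<longrightarrow> kmodule r B \<longrightarrow> isomorphic r L (dsum2 A B) \<longrightarrow>
        zero_module r A \<or> zero_module r B)"

definition has_summand ::
  "'p rel \<Rightarrow> ('p, 'k::field, 'v::ab_group_add) kfunctor \<Rightarrow> ('p, 'k, 'w::ab_group_add) kfunctor \<Rightarrow> bool"
where
  "has_summand r N L \<longleftrightarrow>
     (\<exists>N' :: ('p, 'k, 'v) kfunctor. kmodule r N' \<and> isomorphic r N (dsum2 L N'))"

text \<open>
  \<open>mult r N L\<close> is written \<open>d\<^sub>N(L)\<close>, and \<open>mult_bar r N L\<close> is the same symbol with a bar. Existence and uniqueness of the values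
  selected by \<open>THE\<close> is the Krull--Schmidt theorem (for \<open>mult\<close>, \<open>L\<close> is meant to be indecomposable,
  and for \<open>mult_bar\<close>, \<open>L\<close> is meant to be nonzero).
\<close>

definition mult ::
  "'p rel \<Rightarrow> ('p, 'k::field, 'v::ab_group_add) kfunctor \<Rightarrow> ('p, 'k, 'w::ab_group_add) kfunctor \<Rightarrow> nat"
where
  "mult r N L =
     (THE d. \<exists>n (Ls :: nat \<Rightarrow> ('p, 'k, 'v) kfunctor).
        (\<forall>i<n. indecomposable r (Ls i)) \<and> isomorphic r N (dsum n Ls) \<and>
        d = card {i. i < n \<and> isomorphic r (Ls i) L})"

definition mult_bar ::
  "'p rel \<Rightarrow> ('p, 'k::field, 'v::ab_group_add) kfunctor \<Rightarrow> ('p, 'k, 'w::ab_group_add) kfunctor \<Rightarrow> nat"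
where
  "mult_bar r N L =
     (THE d. \<exists>N' :: ('p, 'k, 'v) kfunctor.
        kmodule r N' \<and> isomorphic r N (dsum2 (dsum d (\<lambda>_. L)) N') \<and> \<not> has_summand r N' L)"

section \<open>Interval modules and restriction\<close>

definition interval_module :: "'p set \<Rightarrow> ('p, 'k::field, 'k) kfunctor" where
  "interval_module I =
     \<lparr>smul = (*),
      obj = (\<lambda>x. if x \<in> I then UNIV else {0}),
      mor = (\<lambda>x y c v. if x \<in> I \<and> y \<in> I then c * v else 0)\<rparr>"

text \<open>
  Precomposition with \<open>k[f]\<close> for an order-preserving map \<open>f\<close>: the functor \<open>k[f]\<close> sends \<open>c\<close> times the
  arrow from \<open>x\<close> to \<open>y\<close> to \<open>c\<close> times the arrow from \<open>f x\<close> to \<open>f y\<close>.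
\<close>

definition restriction :: "('q \<Rightarrow> 'p) \<Rightarrow> ('p, 'k, 'v) kfunctor \<Rightarrow> ('q, 'k, 'v) kfunctor" where
  "restriction f M =
     \<lparr>smul = smul M,
      obj = (\<lambda>x. obj M (f x)),
      mor = (\<lambda>x y c. mor M (f x) (f y) c)\<rparr>"

section \<open>The bipath poset\<close>

text \<open>
  \<open>ZeroHat\<close>, \<open>OneHat\<close>, \<open>Up i\<close>, \<open>Dn i\<close> are the elements written \<open>0\<close>, \<open>1\<close> (with a hat), \<open>i\<close> and \<open>i'\<close>;
  \<open>ZeroBar\<close> occurs only in the poset \<open>Z\<close>.
\<close>

datatype node = ZeroBar | ZeroHat | OneHat | Up nat | Dn nat

definition bipath_set :: "nat \<Rightarrow> nat \<Rightarrow> node set" where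
  "bipath_set n m = {ZeroHat, OneHat} \<union> Up ` {1..n} \<union> Dn ` {1..m}"

definition bipath :: "nat \<Rightarrow> nat \<Rightarrow> node rel" where
  "bipath n m = Restr
     (({(ZeroHat, Up 1)} \<union> {(Up i, Up (i + 1)) |i. 1 \<le> i \<and> i < n} \<union> {(Up n, OneHat)} \<union>
       {(ZeroHat, Dn 1)} \<union> {(Dn i, Dn (i + 1)) |i. 1 \<le> i \<and> i < m} \<union> {(Dn m, OneHat)})\<^sup>*)
     (bipath_set n m)"

definition Zposet :: "nat \<Rightarrow> nat \<Rightarrow> node rel" where
  "Zposet n m = Restr
     (({(ZeroBar, Up 1)} \<union> {(Up i, Up (i + 1)) |i. 1 \<le> i \<and> i < n} \<union> {(Up n, OneHat)} \<union>
       {(ZeroHat, Dn 1)} \<union> {(Dn i, Dn (i + 1)) |i. 1 \<le> i \<and> i < m} \<union> {(Dn m, OneHat)})\<^sup>*)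
     (insert ZeroBar (bipath_set n m))"

definition zeta :: "node \<Rightarrow> node" where
  "zeta x = (if x = ZeroBar then ZeroHat else x)"

definition segment :: "'p rel \<Rightarrow> 'p \<Rightarrow> 'p \<Rightarrow> 'p set" where
  "segment r s t = {x \<in> Field r. (s, x) \<in> r \<and> (x, t) \<in> r}"

definition intervals_u :: "nat \<Rightarrow> nat \<Rightarrow> node set set" where
  "intervals_u n m = {segment (bipath n m) (Up s) (Up t) |s t. 1 \<le> s \<and> s \<le> t \<and> t \<le> n}"

definition intervals_d :: "nat \<Rightarrow> nat \<Rightarrow> node set set" where
  "intervals_d n m = {segment (bipath n m) (Dn s) (Dn t) |s t. 1 \<le> s \<and> s \<le> t \<and> t \<le> m}"

definition intervals_r :: "nat \<Rightarrow> nat \<Rightarrow> node set set" where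
  "intervals_r n m =
     {segment (bipath n m) s OneHat \<union> segment (bipath n m) s' OneHat |s s'.
        s \<in> insert OneHat (Up ` {1..n}) \<and> s' \<in> insert OneHat (Dn ` {1..m})}"

end

theory Submission
  imports Defs
begin

text \<open>
  Call \<open>L\<close> a brick if all its endomorphisms are scalars. For a brick, composition gives a pairing of
  \<open>Hom L N\<close> and \<open>Hom N L\<close> with values in the field. An indecomposable module not isomorphic to \<open>L\<close>
  has zero pairing (a nonzero value would make \<open>L\<close> a direct summand), so any decomposition of \<open>N\<close>
  into indecomposables, and likewise any splitting of a maximal power of \<open>L\<close>, exhibits dual bases
  of the pairing. Hence both multiplicities of \<open>L\<close> in \<open>N\<close> equal the rank of the pairing; this
  replaces the Krull--Schmidt theorem. The intervals in question have a greatest element \<open>x0\<close>, so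
  their modules are bricks before and after restriction, and a composite \<open>L \<rightarrow> N \<rightarrow> L\<close> is determined
  by its component at \<open>x0\<close>. The values at \<open>x0\<close> of the morphisms in either direction are the same
  over both posets, so the two pairings have the same rank.
\<close>

section \<open>Modules and natural transformations\<close>

text \<open>Rank can stand in for uniqueness because two dual bases are compared without any linear
  structure on the hom sets: expanding one in the other factors an identity matrix, so only a set of
  vectors, a set of functionals and the values between them matter. In particular, morphisms that
  differ only at irrelevant arguments never have to be identified. Finiteness of the rank comes from
  the existence of a decomposition into indecomposables, by induction on total dimension.

  The obstacle sits at \<open>ZeroHat\<close>, which has two preimages under \<open>zeta\<close>. A
  morphism over \<open>Z\<close> descends once its components at these agree. For an interval
  avoiding \<open>ZeroHat\<close> they do, since the interval module vanishes there. For the whole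
  poset the space of morphisms out of the restricted interval module can be strictly larger than
  over the bipath poset, so the hom spaces themselves cannot be matched. The surplus is invisible to
  the pairing, which is why everything is evaluated at the greatest element.\<close>

lemma kmodule_vector_space: "kmodule r M \<Longrightarrow> vector_space (smul M)"
  by (simp add: kmodule_def)

lemma kmodule_subspace:
  "kmodule r M \<Longrightarrow> x \<in> Field r \<Longrightarrow> module.subspace (smul M) (obj M x)"
  by (simp add: kmodule_def)

lemma kmodule_finite_span:
  "kmodule r M \<Longrightarrow> x \<in> Field r \<Longrightarrow> \<exists>B. finite B \<and> obj M x = module.span (smul M) B"
  by (simp add: kmodule_def)

lemma kmodule_linear_between:
  "kmodule r M \<Longrightarrow> x \<in> Field r \<Longrightarrow> y \<in> Field r \<Longrightarrow> c \<in> lin_hom r x y \<Longrightarrow>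
    linear_between (smul M) (smul M) (obj M x) (obj M y) (mor M x y c)"
  by (simp add: kmodule_def)

lemma vector_space_module: "vector_space s \<Longrightarrow> module s"
  by (simp add: module_def vector_space_def)

lemma kmodule_smul_zero [simp]:
  assumes "kmodule r M" shows "smul M a 0 = 0"
  by (rule module.scale_zero_right[OF vector_space_module[OF kmodule_vector_space[OF assms]]])

lemma kmodule_smul_smul:
  assumes "kmodule r M" shows "smul M a (smul M b v) = smul M (a * b) v"
  by (rule module.scale_scale[OF vector_space_module[OF kmodule_vector_space[OF assms]]])

lemma kmodule_smul_add:
  assumes "kmodule r M" shows "smul M a (u + v) = smul M a u + smul M a v"
  by (rule module.scale_right_distrib[OF vector_space_module[OF kmodule_vector_space[OF assms]]])

lemma kmodule_smul_diff:
  assumes "kmodule r M" shows "smul M a (u - v) = smul M a u - smul M a v"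
  by (rule module.scale_right_diff_distrib[OF vector_space_module[OF kmodule_vector_space[OF assms]]])

lemma kmodule_smul_sum:
  assumes "kmodule r M" shows "smul M a (sum f S) = (\<Sum>i\<in>S. smul M a (f i))"
  by (rule module.scale_sum_right[OF vector_space_module[OF kmodule_vector_space[OF assms]]])

lemma kmodule_zero_in [simp]:
  assumes "kmodule r M" "x \<in> Field r" shows "0 \<in> obj M x"
  by (rule module.subspace_0[OF vector_space_module[OF kmodule_vector_space[OF assms(1)]]
        kmodule_subspace[OF assms]])

lemma kmodule_add_in:
  assumes "kmodule r M" "x \<in> Field r" "u \<in> obj M x" "v \<in> obj M x" shows "u + v \<in> obj M x"
  by (rule module.subspace_add[OF vector_space_module[OF kmodule_vector_space[OF assms(1)]]
        kmodule_subspace[OF assms(1,2)] assms(3,4)])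

lemma kmodule_diff_in:
  assumes "kmodule r M" "x \<in> Field r" "u \<in> obj M x" "v \<in> obj M x" shows "u - v \<in> obj M x"
  by (rule module.subspace_diff[OF vector_space_module[OF kmodule_vector_space[OF assms(1)]]
        kmodule_subspace[OF assms(1,2)] assms(3,4)])

lemma kmodule_smul_in:
  assumes "kmodule r M" "x \<in> Field r" "v \<in> obj M x" shows "smul M a v \<in> obj M x"
  by (rule module.subspace_scale[OF vector_space_module[OF kmodule_vector_space[OF assms(1)]]
        kmodule_subspace[OF assms(1,2)] assms(3)])

lemma kmodule_sum_in:
  assumes "kmodule r M" "x \<in> Field r" "\<And>i. i \<in> S \<Longrightarrow> f i \<in> obj M x" shows "sum f S \<in> obj M x"
  by (rule module.subspace_sum[OF vector_space_module[OF kmodule_vector_space[OF assms(1)]]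
        kmodule_subspace[OF assms(1,2)] assms(3)])

text \<open>Closure of \<open>V\<close> is assumed directly, not derived from a module: the lemma is
  also applied to values of \<open>dsum\<close>, for which \<open>kmodule\<close> is never
  established.\<close>

lemma linear_between_sum:
  fixes f :: "'v::ab_group_add \<Rightarrow> 'w::ab_group_add"
  assumes "linear_between s t V W f" "0 \<in> V" "\<And>u v. u \<in> V \<Longrightarrow> v \<in> V \<Longrightarrow> u + v \<in> V"
    and "finite S" "\<And>i. i \<in> S \<Longrightarrow> g i \<in> V"
  shows "f (sum g S) = (\<Sum>i\<in>S. f (g i))"
proof -
  have "f (0 + 0) = f 0 + f 0"
    using assms(1,2) unfolding linear_between_def by blast
  then have zero: "f 0 = 0" by simp
  have "sum g S \<in> V \<and> f (sum g S) = (\<Sum>i\<in>S. f (g i))"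
    using assms(4,5)
  proof (induction S rule: finite_induct)
    case empty
    then show ?case using zero assms(2) by simp
  next
    case (insert i S)
    then have "g i \<in> V" "sum g S \<in> V" "f (sum g S) = (\<Sum>i\<in>S. f (g i))" by auto
    moreover from this have "f (g i + sum g S) = f (g i) + f (sum g S)"
      using assms(1) unfolding linear_between_def by blast
    ultimately show ?case using insert(1,2) assms(3) by simp
  qed
  then show ?thesis by simp
qed

lemma linear_between_diff:
  fixes f :: "'v::ab_group_add \<Rightarrow> 'w::ab_group_add"
  assumes "linear_between s t V W f" "u - v \<in> V" "v \<in> V"
  shows "f (u - v) = f u - f v"
proof -
  have "f ((u - v) + v) = f (u - v) + f v"
    using assms unfolding linear_between_def by blast
  then show ?thesis by simp
qed

lemma nat_transI:
  assumes "\<And>x v. x \<in> Field r \<Longrightarrow> v \<in> obj M x \<Longrightarrow> \<phi> x v \<in> obj N x"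
    and "\<And>x u v. x \<in> Field r \<Longrightarrow> u \<in> obj M x \<Longrightarrow> v \<in> obj M x \<Longrightarrow> \<phi> x (u + v) = \<phi> x u + \<phi> x v"
    and "\<And>x a v. x \<in> Field r \<Longrightarrow> v \<in> obj M x \<Longrightarrow> \<phi> x (smul M a v) = smul N a (\<phi> x v)"
    and "\<And>x y c v. x \<in> Field r \<Longrightarrow> y \<in> Field r \<Longrightarrow> c \<in> lin_hom r x y \<Longrightarrow> v \<in> obj M x \<Longrightarrow>
           \<phi> y (mor M x y c v) = mor N x y c (\<phi> x v)"
  shows "nat_trans r M N \<phi>"
  using assms unfolding nat_trans_def linear_between_def by blast

lemma nat_trans_linear_between:
  "nat_trans r M N \<phi> \<Longrightarrow> x \<in> Field r \<Longrightarrow>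
    linear_between (smul M) (smul N) (obj M x) (obj N x) (\<phi> x)"
  by (simp add: nat_trans_def)

lemma nat_trans_in:
  "nat_trans r M N \<phi> \<Longrightarrow> x \<in> Field r \<Longrightarrow> v \<in> obj M x \<Longrightarrow> \<phi> x v \<in> obj N x"
  by (simp add: nat_trans_def linear_between_def)

lemma nat_trans_add:
  "nat_trans r M N \<phi> \<Longrightarrow> x \<in> Field r \<Longrightarrow> u \<in> obj M x \<Longrightarrow> v \<in> obj M x \<Longrightarrow>
    \<phi> x (u + v) = \<phi> x u + \<phi> x v"
  by (simp add: nat_trans_def linear_between_def)

lemma nat_trans_smul:
  "nat_trans r M N \<phi> \<Longrightarrow> x \<in> Field r \<Longrightarrow> v \<in> obj M x \<Longrightarrow> \<phi> x (smul M a v) = smul N a (\<phi> x v)"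
  by (simp add: nat_trans_def linear_between_def)

lemma nat_trans_mor:
  "nat_trans r M N \<phi> \<Longrightarrow> x \<in> Field r \<Longrightarrow> y \<in> Field r \<Longrightarrow> c \<in> lin_hom r x y \<Longrightarrow> v \<in> obj M x \<Longrightarrow>
    \<phi> y (mor M x y c v) = mor N x y c (\<phi> x v)"
  by (simp add: nat_trans_def)

lemma nat_trans_zero:
  fixes M :: "('p, 'k::field, 'v::ab_group_add) kfunctor"
    and N :: "('p, 'k, 'w::ab_group_add) kfunctor"
  assumes "nat_trans r M N \<phi>" "x \<in> Field r" "0 \<in> obj M x"
  shows "\<phi> x 0 = 0"
  using nat_trans_add[OF assms(1-3,3)] by simp

lemma nat_trans_diff:
  assumes "nat_trans r M N \<phi>" "kmodule r M" "x \<in> Field r" "u \<in> obj M x" "v \<in> obj M x"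
  shows "\<phi> x (u - v) = \<phi> x u - \<phi> x v"
  by (rule linear_between_diff[OF nat_trans_linear_between[OF assms(1,3)]
        kmodule_diff_in[OF assms(2-5)] assms(5)])

lemma nat_trans_sum:
  assumes "nat_trans r M N \<phi>" "x \<in> Field r" "0 \<in> obj M x"
    and "\<And>u v. u \<in> obj M x \<Longrightarrow> v \<in> obj M x \<Longrightarrow> u + v \<in> obj M x"
    and "finite S" "\<And>i. i \<in> S \<Longrightarrow> g i \<in> obj M x"
  shows "\<phi> x (sum g S) = (\<Sum>i\<in>S. \<phi> x (g i))"
  by (rule linear_between_sum[OF nat_trans_linear_between[OF assms(1,2)] assms(3-6)])

lemma kmodule_mor_in:
  "kmodule r M \<Longrightarrow> x \<in> Field r \<Longrightarrow> y \<in> Field r \<Longrightarrow> c \<in> lin_hom r x y \<Longrightarrow> v \<in> obj M x \<Longrightarrow>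
    mor M x y c v \<in> obj M y"
  using kmodule_linear_between[of r M x y c] unfolding linear_between_def by blast

lemma kmodule_mor_add:
  "kmodule r M \<Longrightarrow> x \<in> Field r \<Longrightarrow> y \<in> Field r \<Longrightarrow> c \<in> lin_hom r x y \<Longrightarrow> u \<in> obj M x \<Longrightarrow>
    v \<in> obj M x \<Longrightarrow> mor M x y c (u + v) = mor M x y c u + mor M x y c v"
  using kmodule_linear_between[of r M x y c] unfolding linear_between_def by blast

lemma kmodule_mor_zero:
  fixes M :: "('p, 'k::field, 'v::ab_group_add) kfunctor"
  assumes "kmodule r M" "x \<in> Field r" "y \<in> Field r" "c \<in> lin_hom r x y"
  shows "mor M x y c 0 = 0"
  using kmodule_mor_add[OF assms kmodule_zero_in[OF assms(1,2)] kmodule_zero_in[OF assms(1,2)]]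
  by simp

lemma kmodule_mor_diff:
  "kmodule r M \<Longrightarrow> x \<in> Field r \<Longrightarrow> y \<in> Field r \<Longrightarrow> c \<in> lin_hom r x y \<Longrightarrow> u \<in> obj M x \<Longrightarrow>
    v \<in> obj M x \<Longrightarrow> mor M x y c (u - v) = mor M x y c u - mor M x y c v"
  by (rule linear_between_diff[OF kmodule_linear_between kmodule_diff_in])

lemma kmodule_mor_sum:
  assumes "kmodule r M" "x \<in> Field r" "y \<in> Field r" "c \<in> lin_hom r x y"
    and "finite S" "\<And>i. i \<in> S \<Longrightarrow> g i \<in> obj M x"
  shows "mor M x y c (sum g S) = (\<Sum>i\<in>S. mor M x y c (g i))"
  by (rule linear_between_sum[OF kmodule_linear_between[OF assms(1-4)]])
    (use assms kmodule_add_in in auto)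

lemma kmodule_mor_smul:
  "kmodule r M \<Longrightarrow> x \<in> Field r \<Longrightarrow> y \<in> Field r \<Longrightarrow> c \<in> lin_hom r x y \<Longrightarrow> v \<in> obj M x \<Longrightarrow>
    mor M x y c (smul M a v) = smul M a (mor M x y c v)"
  using kmodule_linear_between[of r M x y c] unfolding linear_between_def by blast

lemma kmodule_mor_comp:
  "kmodule r M \<Longrightarrow> x \<in> Field r \<Longrightarrow> y \<in> Field r \<Longrightarrow> z \<in> Field r \<Longrightarrow> c \<in> lin_hom r x y \<Longrightarrow>
    d \<in> lin_hom r y z \<Longrightarrow> v \<in> obj M x \<Longrightarrow> mor M y z d (mor M x y c v) = mor M x z (d * c) v"
  by (simp add: kmodule_def)

lemma kmodule_mor_scalar:
  "kmodule r M \<Longrightarrow> x \<in> Field r \<Longrightarrow> y \<in> Field r \<Longrightarrow> c \<in> lin_hom r x y \<Longrightarrow> v \<in> obj M x \<Longrightarrow>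
    mor M x y (a * c) v = smul M a (mor M x y c v)"
  by (simp add: kmodule_def)

section \<open>Composition and linear combinations of natural transformations\<close>

lemma nat_trans_id: "nat_trans r M M (\<lambda>x v. v)"
  by (simp add: nat_trans_def linear_between_def)

lemma nat_trans_comp:
  assumes "nat_trans r A B \<phi>" "nat_trans r B C \<psi>"
  shows "nat_trans r A C (\<lambda>x v. \<psi> x (\<phi> x v))"
  using assms unfolding nat_trans_def linear_between_def by simp

lemma nat_trans_minus:
  assumes N: "kmodule r N" and "nat_trans r A N \<phi>" "nat_trans r A N \<psi>"
  shows "nat_trans r A N (\<lambda>x v. \<phi> x v - \<psi> x v)"
proof -
  note fg = assms(2,3)
  show ?thesis
    by (rule nat_transI)
      (simp_all add: fg[THEN nat_trans_in] fg[THEN nat_trans_add] fg[THEN nat_trans_smul]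
        fg[THEN nat_trans_mor] kmodule_diff_in[OF N] kmodule_smul_diff[OF N] kmodule_mor_diff[OF N])
qed

lemma nat_trans_sum_trans:
  fixes N :: "('p, 'k::field, 'v::ab_group_add) kfunctor"
  assumes N: "kmodule r N" and "finite S" and f: "\<And>i. i \<in> S \<Longrightarrow> nat_trans r A N (\<phi> i)"
  shows "nat_trans r A N (\<lambda>x v. \<Sum>i\<in>S. \<phi> i x v)"
proof (rule nat_transI)
  fix x u v a assume x: "x \<in> Field r" and u: "u \<in> obj A x" and v: "v \<in> obj A x"
  show "(\<Sum>i\<in>S. \<phi> i x v) \<in> obj N x"
    using nat_trans_in[OF f x v] by (intro kmodule_sum_in[OF N x]) auto
  show "(\<Sum>i\<in>S. \<phi> i x (u + v)) = (\<Sum>i\<in>S. \<phi> i x u) + (\<Sum>i\<in>S. \<phi> i x v)"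
    unfolding sum.distrib[symmetric] by (intro sum.cong refl nat_trans_add[OF f x u v])
  show "(\<Sum>i\<in>S. \<phi> i x (smul A a v)) = smul N a (\<Sum>i\<in>S. \<phi> i x v)"
    unfolding kmodule_smul_sum[OF N] by (intro sum.cong refl nat_trans_smul[OF f x v])
next
  fix x y v and c :: 'k
  assume *: "x \<in> Field r" "y \<in> Field r" "c \<in> lin_hom r x y" "v \<in> obj A x"
  then show "(\<Sum>i\<in>S. \<phi> i y (mor A x y c v)) = mor N x y c (\<Sum>i\<in>S. \<phi> i x v)"
    using nat_trans_mor[OF f *] nat_trans_in[OF f *(1,4)]
    by (simp add: kmodule_mor_sum[OF N *(1-3) \<open>finite S\<close>])
qed

lemma nat_trans_scaled:
  assumes N: "kmodule r N" and f: "nat_trans r A N \<phi>"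
  shows "nat_trans r A N (\<lambda>x v. smul N a (\<phi> x v))"
  by (rule nat_transI)
    (simp_all add: nat_trans_in[OF f] nat_trans_add[OF f] nat_trans_smul[OF f] nat_trans_mor[OF f]
      kmodule_smul_in[OF N] kmodule_smul_add[OF N] kmodule_mor_smul[OF N] kmodule_smul_smul[OF N]
      mult.commute)

section \<open>Submodules and splittings\<close>

text \<open>Only \<open>obj\<close> changes, so the inclusion into \<open>N\<close> is the identity
  function and the ambient type stays the same.\<close>

definition submodule ::
  "('p, 'k, 'v) kfunctor \<Rightarrow> ('p \<Rightarrow> 'v set) \<Rightarrow> ('p, 'k, 'v) kfunctor" where
  "submodule N U = N\<lparr>obj := U\<rparr>"

lemma submodule_simps [simp]:
  "smul (submodule N U) = smul N" "obj (submodule N U) = U" "mor (submodule N U) = mor N"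
  by (simp_all add: submodule_def)

lemma (in vector_space) finite_basis_of_subspace:
  assumes "finite B" "subspace U" "U \<subseteq> span B"
  obtains C where "finite C" "independent C" "U = span C" "card C = dim U"
proof -
  obtain C where C: "C \<subseteq> U" "independent C" "U \<subseteq> span C" "card C = dim U"
    using basis_exists[of U] by blast
  have "finite C"
    using independent_span_bound[OF assms(1) C(2)] C(1) assms(3) by blast
  moreover have "U = span C"
    using C(1,3) assms(2) span_minimal by blast
  ultimately show thesis using that C by blast
qed

text \<open>The ambient space may be infinite-dimensional, so dimensions are compared through finite
  bases inside the finitely generated \<open>W\<close>; a vector of \<open>W\<close> outside
  \<open>U\<close> enlarges a basis of \<open>U\<close>.\<close>

lemma (in vector_space) dim_subspace_le:
  assumes "finite B" "subspace U" "subspace W" "U \<subseteq> W" "W = span B"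
  shows "dim U \<le> dim W" "U \<noteq> W \<Longrightarrow> dim U < dim W"
proof -
  obtain C where C: "finite C" "independent C" "U = span C" "card C = dim U"
    using finite_basis_of_subspace[of B U] assms by blast
  obtain D where D: "finite D" "independent D" "W = span D" "card D = dim W"
    using finite_basis_of_subspace[of B W] assms by blast
  have CW: "C \<subseteq> span D" using C(3) D(3) assms(4) span_superset by blast
  show "dim U \<le> dim W"
    using independent_span_bound[OF D(1) C(2) CW] C(4) D(4) by simp
  show "dim U < dim W" if "U \<noteq> W"
  proof -
    obtain w where w: "w \<in> W" "w \<notin> span C" using \<open>U \<noteq> W\<close> assms(4) C(3) by blast
    have "independent (insert w C)" using w C(2) by (simp add: independent_insert)
    moreover have "insert w C \<subseteq> span D" using w D(3) CW by blast
    ultimately have "card (insert w C) \<le> card D"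
      using independent_span_bound[OF D(1)] by blast
    moreover have "w \<notin> C" using w(2) span_base by blast
    ultimately show ?thesis using C(1,4) D(4) by simp
  qed
qed

lemma kmodule_submodule:
  fixes N :: "('p, 'k::field, 'v::ab_group_add) kfunctor"
  assumes N: "kmodule r N"
    and sub: "\<And>x. x \<in> Field r \<Longrightarrow> module.subspace (smul N) (U x)"
    and le: "\<And>x. x \<in> Field r \<Longrightarrow> U x \<subseteq> obj N x"
    and mor: "\<And>x y c v. x \<in> Field r \<Longrightarrow> y \<in> Field r \<Longrightarrow> c \<in> lin_hom r x y \<Longrightarrow> v \<in> U x \<Longrightarrow>
      mor N x y c v \<in> U y"
  shows "kmodule r (submodule N U)"
proof -
  interpret vector_space "smul N" using N by (rule kmodule_vector_space)
  have fin: "\<exists>B. finite B \<and> U x = span B" if x: "x \<in> Field r" for x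
  proof -
    obtain B where "finite B" "obj N x = span B" using kmodule_finite_span[OF N x] by blast
    then show ?thesis using finite_basis_of_subspace[of B "U x"] sub[OF x] le[OF x] by metis
  qed
  show ?thesis
    unfolding kmodule_def submodule_simps linear_between_def
  proof (intro conjI ballI allI)
    fix x y and a c d :: 'k and v
    assume "x \<in> Field r" "y \<in> Field r" "c \<in> lin_hom r x y" "d \<in> lin_hom r x y" "v \<in> U x"
    moreover from this have "v \<in> obj N x" using le by blast
    ultimately show "mor N x y (c + d) v = mor N x y c v + mor N x y d v"
      "mor N x y (a * c) v = smul N a (mor N x y c v)"
      using N by (simp_all add: kmodule_def)
  next
    fix x v assume "x \<in> Field r" "v \<in> U x"
    moreover from this have "v \<in> obj N x" using le by blast
    ultimately show "mor N x x 1 v = v" using N by (simp add: kmodule_def)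
  next
    fix x y z and c d :: 'k and v
    assume "x \<in> Field r" "y \<in> Field r" "z \<in> Field r" "c \<in> lin_hom r x y" "d \<in> lin_hom r y z" "v \<in> U x"
    then show "mor N x z (d * c) v = mor N y z d (mor N x y c v)"
      using kmodule_mor_comp[OF N] le by (metis subsetD)
  next
    fix x y u v and c :: 'k
    assume "x \<in> Field r" "y \<in> Field r" "c \<in> lin_hom r x y" "u \<in> U x" "v \<in> U x"
    then show "mor N x y c (u + v) = mor N x y c u + mor N x y c v"
      using kmodule_mor_add[OF N] le by (metis subsetD)
  next
    fix x y v and c a :: 'k
    assume "x \<in> Field r" "y \<in> Field r" "c \<in> lin_hom r x y" "v \<in> U x"
    then show "mor N x y c (smul N a v) = smul N a (mor N x y c v)"
      using kmodule_mor_smul[OF N] le by (metis subsetD)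
  qed (use fin sub mor vector_space_axioms in auto)
qed

text \<open>The target is only asked to preserve zero, because in
  \<open>exists_mult_bar_decomposition\<close> it is a power of \<open>L\<close> built with
  \<open>dsum\<close>.\<close>

lemma kmodule_ker:
  fixes N :: "('p, 'k::field, 'v::ab_group_add) kfunctor"
  assumes N: "kmodule r N" and e: "nat_trans r N A g"
    and A: "\<And>a. smul A a 0 = 0"
      "\<And>x y c. x \<in> Field r \<Longrightarrow> y \<in> Field r \<Longrightarrow> c \<in> lin_hom r x y \<Longrightarrow> mor A x y c 0 = 0"
  shows "kmodule r (submodule N (\<lambda>x. {v \<in> obj N x. g x v = 0}))"
proof (rule kmodule_submodule[OF N])
  interpret vector_space "smul N" using N by (rule kmodule_vector_space)
  show "subspace {v \<in> obj N x. g x v = 0}" if "x \<in> Field r" for x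
    using nat_trans_zero[OF e that] A(1) N that
    by (auto intro!: subspaceI simp: nat_trans_add[OF e that] nat_trans_smul[OF e that]
        kmodule_add_in[OF N that] kmodule_smul_in[OF N that])
qed (auto simp: nat_trans_mor[OF e] kmodule_mor_in[OF N] A(2))

lemma kmodule_image:
  fixes N :: "('p, 'k::field, 'v::ab_group_add) kfunctor"
  assumes N: "kmodule r N" and A: "kmodule r A" and f: "nat_trans r A N f"
  shows "kmodule r (submodule N (\<lambda>x. f x ` obj A x))"
proof (rule kmodule_submodule[OF N])
  interpret vector_space "smul N" using N by (rule kmodule_vector_space)
  show "subspace (f x ` obj A x)" if x: "x \<in> Field r" for x
  proof (rule subspaceI)
    show "0 \<in> f x ` obj A x"
      using nat_trans_zero[OF f x] A x by (metis imageI kmodule_zero_in)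
    show "u + v \<in> f x ` obj A x" if "u \<in> f x ` obj A x" "v \<in> f x ` obj A x" for u v
      using that nat_trans_add[OF f x] kmodule_add_in[OF A x] by (smt (verit) image_iff)
    show "smul N a v \<in> f x ` obj A x" if "v \<in> f x ` obj A x" for a v
      using that nat_trans_smul[OF f x] kmodule_smul_in[OF A x] by (smt (verit) image_iff)
  qed
  show "mor N x y c v \<in> f y ` obj A y"
    if "x \<in> Field r" "y \<in> Field r" "c \<in> lin_hom r x y" "v \<in> f x ` obj A x" for x y c v
    using that nat_trans_mor[OF f] kmodule_mor_in[OF A] by (smt (verit) image_iff)
qed (use f in \<open>auto simp: nat_trans_in\<close>)

lemma nat_trans_into_submodule:
  assumes "nat_trans r A N f" "\<And>x v. x \<in> Field r \<Longrightarrow> v \<in> obj A x \<Longrightarrow> f x v \<in> U x"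
  shows "nat_trans r A (submodule N U) f"
  using assms unfolding nat_trans_def linear_between_def by simp

lemma nat_trans_from_submodule:
  assumes "nat_trans r N A g" "\<And>x. x \<in> Field r \<Longrightarrow> U x \<subseteq> obj N x"
  shows "nat_trans r (submodule N U) A g"
  using assms unfolding nat_trans_def linear_between_def by (auto simp: subset_iff)

text \<open>The composite of \<open>g\<close> followed by \<open>f\<close> is idempotent, which
  splits \<open>N\<close> into the image of \<open>f\<close> and the kernel of \<open>g\<close>. The
  inverse isomorphisms send \<open>v\<close> to \<open>(g x v, v - f x (g x v))\<close> and
  \<open>(a, b)\<close> to \<open>f x a + b\<close>.\<close>

lemma isomorphic_dsum2_of_retract:
  fixes N :: "('p, 'k::field, 'v::ab_group_add) kfunctor"
    and A :: "('p, 'k, 'w::ab_group_add) kfunctor"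
  assumes N: "kmodule r N" and f: "nat_trans r A N f" and g: "nat_trans r N A g"
    and gf: "\<And>x v. x \<in> Field r \<Longrightarrow> v \<in> obj A x \<Longrightarrow> g x (f x v) = v"
  shows "isomorphic r N (dsum2 A (submodule N (\<lambda>x. {v \<in> obj N x. g x v = 0})))"
    (is "isomorphic r N ?S")
proof -
  have gdiff: "g x (u - v) = g x u - g x v" if "x \<in> Field r" "u \<in> obj N x" "v \<in> obj N x" for x u v
    by (rule nat_trans_diff[OF g N that])
  have fg: "nat_trans r N N (\<lambda>x v. v - f x (g x v))"
    using nat_trans_minus[OF N nat_trans_id nat_trans_comp[OF g f]] .
  have 1: "nat_trans r N ?S (\<lambda>x v. (g x v, v - f x (g x v)))"
    using g fg gf unfolding nat_trans_def linear_between_def dsum2_def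
    by (auto simp: gdiff) (metis gdiff diff_self f nat_trans_in)
  have 2: "nat_trans r ?S N (\<lambda>x (a, b). f x a + b)"
  proof (rule nat_transI)
    fix x and u v :: "'w \<times> 'v"
    assume x: "x \<in> Field r" and u: "u \<in> obj ?S x" and v: "v \<in> obj ?S x"
    then show "(case u + v of (a, b) \<Rightarrow> f x a + b) =
        (case u of (a, b) \<Rightarrow> f x a + b) + (case v of (a, b) \<Rightarrow> f x a + b)"
      using nat_trans_add[OF f x] by (auto simp: dsum2_def)
  qed (use f N in \<open>auto simp: dsum2_def nat_trans_in nat_trans_smul nat_trans_mor kmodule_add_in
          kmodule_smul_add kmodule_mor_add\<close>)
  show ?thesis
    unfolding isomorphic_def
    using 1 2 gf by (intro exI[of _ "\<lambda>x v. (g x v, v - f x (g x v))"] exI[of _ "\<lambda>x (a, b). f x a + b"])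
      (auto simp: dsum2_def nat_trans_add[OF g] nat_trans_in[OF f])
qed

section \<open>Dual bases of a pairing\<close>

text \<open>An identity matrix of size \<open>card S\<close> factors through the space of dimension
  \<open>card T\<close>: the vectors \<open>B j\<close> have the rows of \<open>A\<close> as dual
  functionals, hence are independent.\<close>

lemma card_le_of_matrix_factorization:
  fixes A B :: "'i \<Rightarrow> 'j \<Rightarrow> 'k::field"
  assumes "finite S" "finite T"
    and AB: "\<And>i j. i \<in> S \<Longrightarrow> j \<in> S \<Longrightarrow> (\<Sum>l\<in>T. A i l * B j l) = (if i = j then 1 else 0)"
  shows "card S \<le> card T"
proof -
  define scl :: "'k \<Rightarrow> ('j \<Rightarrow> 'k) \<Rightarrow> 'j \<Rightarrow> 'k" where "scl a f = (\<lambda>l. a * f l)" for a f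
  interpret vs: vector_space scl
    by unfold_locales (auto simp: scl_def fun_eq_iff algebra_simps)
  \<comment> \<open>The index type may be infinite; cutting \<open>B j\<close> off outside
    \<open>T\<close> puts it into the span of the unit vectors \<open>e l\<close> with
    \<open>l\<close> in \<open>T\<close>. The functional \<open>p i\<close> is row \<open>i\<close>
    of \<open>A\<close>.\<close>
  define b where "b j = (\<lambda>l. if l \<in> T then B j l else 0)" for j
  define e :: "'j \<Rightarrow> 'j \<Rightarrow> 'k" where "e l = (\<lambda>l'. if l' = l then 1 else 0)" for l
  define p where "p i f = (\<Sum>l\<in>T. A i l * f l)" for i and f :: "'j \<Rightarrow> 'k"
  have p_b: "p i (b j) = (if i = j then 1 else 0)" if "i \<in> S" "j \<in> S" for i j
    using AB[OF that] by (simp add: p_def b_def)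
  have p_scl: "p i (scl a f) = a * p i f" for i a f
    by (simp add: p_def scl_def sum_distrib_left algebra_simps)
  have p_add: "p i (f + g) = p i f + p i g" for i f g
    by (simp add: p_def algebra_simps sum.distrib)
  have p_zero: "p i 0 = 0" for i by (simp add: p_def)
  have p_sum: "p i (sum g X) = (\<Sum>x\<in>X. p i (g x))" for i X and g :: "'x \<Rightarrow> 'j \<Rightarrow> 'k"
  proof (induction X rule: infinite_finite_induct)
    case (insert x X)
    show ?case unfolding sum.insert[OF insert(1,2)] p_add insert(3) by (rule refl)
  qed (simp_all add: p_zero[unfolded zero_fun_def])
  have inj: "inj_on b S"
    by (rule inj_onI) (metis p_b one_neq_zero)
  have "vs.independent (b ` S)"
  proof (rule vs.independent_if_scalars_zero)
    fix f v assume *: "(\<Sum>x\<in>b ` S. scl (f x) x) = 0" and "v \<in> b ` S"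
    then obtain i where i: "i \<in> S" "v = b i" by blast
    have "0 = p i (\<Sum>x\<in>b ` S. scl (f x) x)" by (simp add: * p_zero)
    also have "\<dots> = (\<Sum>j\<in>S. f (b j) * p i (b j))"
      by (simp add: p_sum p_scl sum.reindex[OF inj])
    also have "\<dots> = (\<Sum>j\<in>S. if i = j then f (b j) else 0)"
      by (intro sum.cong refl) (simp add: p_b i)
    also have "\<dots> = f v" using i \<open>finite S\<close> by simp
    finally show "f v = 0" by simp
  qed (use \<open>finite S\<close> in simp)
  moreover have "b ` S \<subseteq> vs.span (e ` T)"
  proof
    fix v assume "v \<in> b ` S"
    then obtain j where "v = b j" by blast
    have "b j = (\<Sum>l\<in>T. scl (B j l) (e l))"
    proof
      fix l
      have "(\<Sum>k\<in>T. scl (B j k) (e k)) l = (\<Sum>k\<in>T. scl (B j k) (e k) l)"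
        by (induction T rule: infinite_finite_induct) auto
      then show "b j l = (\<Sum>k\<in>T. scl (B j k) (e k)) l"
        using \<open>finite T\<close> by (simp add: scl_def e_def b_def if_distrib cong: if_cong)
    qed
    then show "v \<in> vs.span (e ` T)"
      using \<open>v = b j\<close> by (simp add: vs.span_sum vs.span_scale vs.span_base)
  qed
  ultimately have "card (b ` S) \<le> card (e ` T)"
    using vs.independent_span_bound[of "e ` T" "b ` S"] \<open>finite T\<close> by simp
  also have "\<dots> \<le> card T" using \<open>finite T\<close> by (rule card_image_le)
  finally show ?thesis by (simp add: card_image[OF inj])
qed

text \<open>\<open>F\<close> and \<open>G\<close> are mere sets. The last condition bounds the rank
  of the evaluation pairing between them by \<open>card S\<close>, and duality of the two families
  shows that this rank is attained.\<close>

definition dual_basis ::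
  "'v set \<Rightarrow> ('v \<Rightarrow> 'k::field) set \<Rightarrow> 'i set \<Rightarrow> ('i \<Rightarrow> 'v) \<Rightarrow> ('i \<Rightarrow> 'v \<Rightarrow> 'k) \<Rightarrow> bool" where
  "dual_basis F G S u \<gamma> \<longleftrightarrow> finite S \<and> u ` S \<subseteq> F \<and> \<gamma> ` S \<subseteq> G \<and>
     (\<forall>i\<in>S. \<forall>j\<in>S. \<gamma> i (u j) = (if i = j then 1 else 0)) \<and>
     (\<forall>v\<in>F. \<forall>\<delta>\<in>G. \<delta> v = (\<Sum>i\<in>S. \<delta> (u i) * \<gamma> i v))"

text \<open>Expanding \<open>\<gamma> i (u j)\<close> in the second dual basis writes the identity
  matrix over \<open>S\<close> as a product through \<open>T\<close>.\<close>

lemma dual_basis_card_le: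
  assumes "dual_basis F G S u \<gamma>" "dual_basis F G T w \<delta>"
  shows "card S \<le> card T"
proof (rule card_le_of_matrix_factorization[of S T "\<lambda>i l. \<gamma> i (w l)" "\<lambda>j l. \<delta> l (u j)"])
  fix i j assume "i \<in> S" "j \<in> S"
  then have "u j \<in> F" "\<gamma> i \<in> G" "\<gamma> i (u j) = (if i = j then 1 else 0)"
    using assms(1) by (auto simp: dual_basis_def)
  moreover from this have "\<gamma> i (u j) = (\<Sum>l\<in>T. \<gamma> i (w l) * \<delta> l (u j))"
    using assms(2) by (auto simp: dual_basis_def)
  ultimately show "(\<Sum>l\<in>T. \<gamma> i (w l) * \<delta> l (u j)) = (if i = j then 1 else 0)"
    by simp
qed (use assms in \<open>auto simp: dual_basis_def\<close>)

lemma dual_basis_card_unique: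
  assumes "dual_basis F G S u \<gamma>" "dual_basis F G T w \<delta>"
  shows "card S = card T"
  using dual_basis_card_le[OF assms] dual_basis_card_le[OF assms(2,1)] by simp

text \<open>\<open>dsum\<close> is indexed by an initial segment of the naturals, so splitting off a
  power of \<open>L\<close> calls for a dual basis indexed in the same way.\<close>

lemma dual_basis_reindex:
  assumes "dual_basis F G S u \<gamma>"
  shows "\<exists>w \<delta>. dual_basis F G {..<card S} w \<delta>"
proof -
  have "finite S" using assms by (simp add: dual_basis_def)
  then obtain h where h: "bij_betw h {..<card S} S"
    using ex_bij_betw_nat_finite[of S] by (auto simp: atLeast0LessThan)
  have "dual_basis F G {..<card S} (u \<circ> h) (\<gamma> \<circ> h)"
    unfolding dual_basis_def
  proof (intro conjI ballI)
    fix i j assume "i \<in> {..<card S}" "j \<in> {..<card S}"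
    moreover from this have "h i \<in> S" "h j \<in> S" using h bij_betwE by blast+
    moreover have "inj_on h {..<card S}" using h by (rule bij_betw_imp_inj_on)
    ultimately show "(\<gamma> \<circ> h) i ((u \<circ> h) j) = (if i = j then 1 else 0)"
      using assms by (auto simp: dual_basis_def inj_on_eq_iff)
  next
    fix v \<delta> assume "v \<in> F" "\<delta> \<in> G"
    then have "\<delta> v = (\<Sum>i\<in>S. \<delta> (u i) * \<gamma> i v)" using assms by (auto simp: dual_basis_def)
    also have "\<dots> = (\<Sum>i<card S. \<delta> (u (h i)) * \<gamma> (h i) v)"
      by (rule sum.reindex_bij_betw[OF h, symmetric])
    finally show "\<delta> v = (\<Sum>i<card S. \<delta> ((u \<circ> h) i) * (\<gamma> \<circ> h) i v)" by simp
  qed (use assms bij_betw_imp_surj_on[OF h] in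
      \<open>auto simp: dual_basis_def image_comp[symmetric] simp del: image_comp\<close>)
  then show ?thesis by blast
qed

section \<open>Direct sums\<close>

lemma dsum_simps [simp]:
  "smul (dsum n L) = (\<lambda>a f i. if i < n then smul (L i) a (f i) else smul (L 0) a (f i))"
  "obj (dsum n L) = (\<lambda>x. {f. (\<forall>i<n. f i \<in> obj (L i) x) \<and> (\<forall>i\<ge>n. f i = 0)})"
  "mor (dsum n L) = (\<lambda>x y c f i. if i < n then mor (L i) x y c (f i) else 0)"
  by (simp_all add: dsum_def)

lemma dsum2_simps [simp]:
  "smul (dsum2 M N) a (v, w) = (smul M a v, smul N a w)"
  "obj (dsum2 M N) x = obj M x \<times> obj N x"
  "mor (dsum2 M N) x y c (v, w) = (mor M x y c v, mor N x y c w)"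
  by (simp_all add: dsum2_def)

text \<open>This is what a summand must satisfy for the other one to embed into the direct sum by
  padding with zero. It holds for modules and, by a direct check, for \<open>dsum\<close>.\<close>

definition pointed :: "'p rel \<Rightarrow> ('p, 'k::field, 'v::ab_group_add) kfunctor \<Rightarrow> bool" where
  "pointed r M \<longleftrightarrow> (\<forall>a. smul M a 0 = 0) \<and> (\<forall>x\<in>Field r. 0 \<in> obj M x) \<and>
     (\<forall>x\<in>Field r. \<forall>y\<in>Field r. \<forall>c\<in>lin_hom r x y. mor M x y c 0 = 0)"

lemma kmodule_pointed: "kmodule r M \<Longrightarrow> pointed r M"
  by (simp add: pointed_def kmodule_mor_zero)

text \<open>Entries from index \<open>n\<close> on are scaled by \<open>smul (L 0)\<close>. For
  \<open>n = 0\<close> the first assumption says nothing about \<open>L 0\<close>, so preservation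
  of zero is assumed separately, here and in the later lemmas on \<open>dsum\<close>.\<close>

lemma pointed_dsum:
  fixes L :: "nat \<Rightarrow> ('p, 'k::field, 'v::ab_group_add) kfunctor"
  assumes "\<And>i. i < n \<Longrightarrow> kmodule r (L i)" "\<And>a. smul (L 0) a 0 = 0"
  shows "pointed r (dsum n L)"
  unfolding pointed_def
proof (intro conjI ballI allI)
  fix a show "smul (dsum n L) a 0 = 0"
    using assms kmodule_smul_zero by (fastforce simp: fun_eq_iff)
next
  fix x assume "x \<in> Field r"
  then show "0 \<in> obj (dsum n L) x" using kmodule_zero_in[OF assms(1)] by simp
next
  fix x y and c :: 'k assume "x \<in> Field r" "y \<in> Field r" "c \<in> lin_hom r x y"
  then show "mor (dsum n L) x y c 0 = 0"
    using kmodule_mor_zero[OF assms(1)] by (auto simp: fun_eq_iff)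
qed

lemma nat_trans_dsum2_fst: "nat_trans r (dsum2 A B) A (\<lambda>x. fst)"
  by (rule nat_transI) auto

lemma nat_trans_dsum2_snd: "nat_trans r (dsum2 A B) B (\<lambda>x. snd)"
  by (rule nat_transI) auto

lemma nat_trans_dsum2_left:
  "pointed r B \<Longrightarrow> nat_trans r A (dsum2 A B) (\<lambda>x v. (v, 0))"
  by (rule nat_transI) (auto simp: pointed_def)

lemma nat_trans_dsum2_right:
  "pointed r A \<Longrightarrow> nat_trans r B (dsum2 A B) (\<lambda>x v. (0, v))"
  by (rule nat_transI) (auto simp: pointed_def)

lemma nat_trans_dsum_proj: "i < n \<Longrightarrow> nat_trans r (dsum n L) (L i) (\<lambda>x f. f i)"
  by (rule nat_transI) auto

lemma nat_trans_dsum_inj: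
  assumes L: "\<And>j. j < n \<Longrightarrow> kmodule r (L j)" and i: "i < n"
  shows "nat_trans r (L i) (dsum n L) (\<lambda>x v j. if j = i then v else 0)"
proof -
  have *: "smul (L j) a 0 = 0" if "j < n" for j a using L[OF that] by simp
  have **: "smul (L 0) a 0 = 0" for a using * i by (metis gr_zeroI not_less_zero)
  show ?thesis
    by (rule nat_transI)
      (use i in \<open>auto simp: fun_eq_iff * ** kmodule_mor_zero[OF L] kmodule_zero_in[OF L]\<close>)
qed

lemma nat_trans_to_dsum:
  assumes L0: "\<And>a. smul (L 0) a 0 = 0" and \<pi>: "\<And>i. i < n \<Longrightarrow> nat_trans r N (L i) (\<pi> i)"
  shows "nat_trans r N (dsum n L) (\<lambda>x v i. if i < n then \<pi> i x v else 0)"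
  by (rule nat_transI)
    (auto simp: L0 fun_eq_iff \<pi>[THEN nat_trans_in] \<pi>[THEN nat_trans_add] \<pi>[THEN nat_trans_smul]
      \<pi>[THEN nat_trans_mor])

lemma nat_trans_from_dsum:
  assumes N: "kmodule r N" and \<iota>: "\<And>i. i < n \<Longrightarrow> nat_trans r (L i) N (\<iota> i)"
  shows "nat_trans r (dsum n L) N (\<lambda>x f. \<Sum>i<n. \<iota> i x (f i))"
  by (rule nat_trans_sum_trans[OF N finite_lessThan])
    (use nat_trans_comp[OF nat_trans_dsum_proj \<iota>] in auto)

lemma dsum_expand:
  fixes L :: "nat \<Rightarrow> ('p, 'k::field, 'v::ab_group_add) kfunctor"
  assumes "f \<in> obj (dsum n L) x"
  shows "f = (\<Sum>i<n. (\<lambda>j. if j = i then f i else 0))"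
proof
  fix j
  have "(\<Sum>i<k. (\<lambda>j. if j = i then f i else 0)) j = (if j < k then f j else 0)" for k
    by (induction k) auto
  then show "f j = (\<Sum>i<n. (\<lambda>j. if j = i then f i else 0)) j" using assms by simp
qed

lemma nat_trans_dsum_expand:
  assumes L: "\<And>i. i < n \<Longrightarrow> kmodule r (L i)" and \<phi>: "nat_trans r (dsum n L) N \<phi>"
    and x: "x \<in> Field r" and f: "f \<in> obj (dsum n L) x"
  shows "\<phi> x f = (\<Sum>i<n. \<phi> x (\<lambda>j. if j = i then f i else 0))"
  by (subst dsum_expand[OF f], rule nat_trans_sum[OF \<phi> x])
    (use f kmodule_zero_in[OF L x] kmodule_add_in[OF L x] in auto)

text \<open>An internal form of an isomorphism with \<open>dsum n L\<close>: expressed by injections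
  and projections, decompositions of two complementary submodules can simply be
  concatenated.\<close>

definition biproduct ::
  "'p rel \<Rightarrow> ('p, 'k::field, 'v::ab_group_add) kfunctor \<Rightarrow> nat \<Rightarrow>
    (nat \<Rightarrow> ('p, 'k, 'w::ab_group_add) kfunctor) \<Rightarrow>
    (nat \<Rightarrow> 'p \<Rightarrow> 'w \<Rightarrow> 'v) \<Rightarrow> (nat \<Rightarrow> 'p \<Rightarrow> 'v \<Rightarrow> 'w) \<Rightarrow> bool" where
  "biproduct r N n L \<iota> \<pi> \<longleftrightarrow>
     (\<forall>i<n. nat_trans r (L i) N (\<iota> i) \<and> nat_trans r N (L i) (\<pi> i)) \<and>
     (\<forall>i<n. \<forall>j<n. \<forall>x\<in>Field r. \<forall>v\<in>obj (L j) x. \<pi> i x (\<iota> j x v) = (if i = j then v else 0)) \<and>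
     (\<forall>x\<in>Field r. \<forall>v\<in>obj N x. v = (\<Sum>i<n. \<iota> i x (\<pi> i x v)))"

lemma biproduct_isomorphic:
  assumes N: "kmodule r N" and L: "\<And>i. i < n \<Longrightarrow> kmodule r (L i)" and L0: "\<And>a. smul (L 0) a 0 = 0"
    and b: "biproduct r N n L \<iota> \<pi>"
  shows "isomorphic r N (dsum n L)"
proof -
  have \<iota>: "nat_trans r (L i) N (\<iota> i)" and \<pi>: "nat_trans r N (L i) (\<pi> i)" if "i < n" for i
    using b that by (auto simp: biproduct_def)
  let ?f = "\<lambda>x v i. if i < n then \<pi> i x v else 0" and ?g = "\<lambda>x f. \<Sum>i<n. \<iota> i x (f i)"
  have "?f x (?g x w) = w" if x: "x \<in> Field r" and w: "w \<in> obj (dsum n L) x" for x w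
  proof
    fix i
    have "\<pi> i x (?g x w) = w i" if i: "i < n"
    proof -
      have "\<pi> i x (?g x w) = (\<Sum>j<n. \<pi> i x (\<iota> j x (w j)))"
        by (rule nat_trans_sum[OF \<pi>[OF i] x])

          (use x w in \<open>auto simp: kmodule_zero_in[OF N] kmodule_add_in[OF N] nat_trans_in[OF \<iota>]\<close>)
      also have "\<dots> = (\<Sum>j<n. if i = j then w j else 0)"
        using b w x i by (intro sum.cong) (auto simp: biproduct_def)
      finally show ?thesis using i by simp
    qed
    then show "?f x (?g x w) i = w i" using w by auto
  qed
  moreover have "?g x (?f x v) = v" if "x \<in> Field r" "v \<in> obj N x" for x v
    using b that by (simp add: biproduct_def)
  ultimately show ?thesis
    unfolding isomorphic_def
    using nat_trans_to_dsum[where L = L and \<pi> = \<pi>, OF L0 \<pi>]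
      nat_trans_from_dsum[where L = L and \<iota> = \<iota>, OF N \<iota>] by blast
qed

lemma isomorphic_biproduct:
  fixes L :: "nat \<Rightarrow> ('p, 'k::field, 'w::ab_group_add) kfunctor"
  assumes L: "\<And>i. i < n \<Longrightarrow> kmodule r (L i)"
    and iso: "isomorphic r N (dsum n L)"
  shows "\<exists>\<iota> \<pi>. biproduct r N n L \<iota> \<pi>"
proof -
  obtain \<phi> \<psi> where \<phi>: "nat_trans r N (dsum n L) \<phi>" and \<psi>: "nat_trans r (dsum n L) N \<psi>"
    and inv: "\<And>x v. x \<in> Field r \<Longrightarrow> v \<in> obj N x \<Longrightarrow> \<psi> x (\<phi> x v) = v"
      "\<And>x w. x \<in> Field r \<Longrightarrow> w \<in> obj (dsum n L) x \<Longrightarrow> \<phi> x (\<psi> x w) = w"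
    using iso unfolding isomorphic_def by blast
  note inj = nat_trans_dsum_inj[where n = n and r = r and L = L, OF L]
  have "biproduct r N n L (\<lambda>i x v. \<psi> x (\<lambda>j. if j = i then v else 0)) (\<lambda>i x v. \<phi> x v i)"
    unfolding biproduct_def
  proof (intro conjI allI ballI impI)
    fix i assume i: "i < n"
    show "nat_trans r (L i) N (\<lambda>x v. \<psi> x (\<lambda>j. if j = i then v else 0))"
      using nat_trans_comp[OF inj[OF _ i] \<psi>] .
    show "nat_trans r N (L i) (\<lambda>x v. \<phi> x v i)"
      using nat_trans_comp[OF \<phi> nat_trans_dsum_proj[OF i]] .
    fix j x v assume j: "j < n" and x: "x \<in> Field r" and v: "v \<in> obj (L j) x"
    show "\<phi> x (\<psi> x (\<lambda>k. if k = j then v else 0)) i = (if i = j then v else 0)"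
      using inv(2)[OF x nat_trans_in[OF inj[OF _ j] x v]] by simp
  next
    fix x v assume x: "x \<in> Field r" and v: "v \<in> obj N x"
    show "v = (\<Sum>i<n. \<psi> x (\<lambda>j. if j = i then \<phi> x v i else 0))"
      using nat_trans_dsum_expand[OF L \<psi> x nat_trans_in[OF \<phi> x v]] inv(1)[OF x v] by simp
  qed
  then show ?thesis by blast
qed

section \<open>Decomposition into indecomposables\<close>

text \<open>The projection onto \<open>A\<close>, transported to \<open>N\<close>, is an idempotent
  \<open>e\<close>. Its image and kernel are summands lying inside \<open>N\<close>, where
  dimensions can be compared. That \<open>A\<close> is nonzero gives \<open>e\<close> nonzero, and
  that \<open>B\<close> is nonzero keeps \<open>e\<close> from being the identity.\<close>

lemma split_of_not_indecomposable:
  fixes N :: "('p, 'k::field, 'v::ab_group_add) kfunctor"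
  assumes N: "kmodule r N" and "\<not> zero_module r N" "\<not> indecomposable r N"
  obtains e where "nat_trans r N N e"
    "\<And>x v. x \<in> Field r \<Longrightarrow> v \<in> obj N x \<Longrightarrow> e x (e x v) = e x v"
    "\<exists>x\<in>Field r. \<exists>v\<in>obj N x. e x v \<noteq> 0" "\<exists>x\<in>Field r. \<exists>v\<in>obj N x. e x v \<noteq> v"
proof -
  obtain A B :: "('p, 'k, 'v) kfunctor"
    where A: "kmodule r A" "\<not> zero_module r A" and B: "kmodule r B" "\<not> zero_module r B"
      and iso: "isomorphic r N (dsum2 A B)"
    using assms unfolding indecomposable_def by blast
  obtain \<phi> \<psi> where \<phi>: "nat_trans r N (dsum2 A B) \<phi>" and \<psi>: "nat_trans r (dsum2 A B) N \<psi>"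
    and inv: "\<And>x v. x \<in> Field r \<Longrightarrow> v \<in> obj N x \<Longrightarrow> \<psi> x (\<phi> x v) = v"
      "\<And>x w. x \<in> Field r \<Longrightarrow> w \<in> obj (dsum2 A B) x \<Longrightarrow> \<phi> x (\<psi> x w) = w"
    using iso unfolding isomorphic_def by blast
  define e where "e = (\<lambda>x v. \<psi> x (fst (\<phi> x v), 0))"
  have e: "nat_trans r N N e"
    unfolding e_def
    using nat_trans_comp[OF nat_trans_comp[OF nat_trans_comp[OF \<phi> nat_trans_dsum2_fst]
          nat_trans_dsum2_left[OF kmodule_pointed[OF B(1)]]] \<psi>] .
  have \<phi>_e: "\<phi> x (e x v) = (fst (\<phi> x v), 0)" if "x \<in> Field r" "v \<in> obj N x" for x v
    using inv(2)[OF that(1), of "(fst (\<phi> x v), 0)"] nat_trans_in[OF \<phi> that]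
      kmodule_zero_in[OF B(1) that(1)] by (auto simp: e_def)
  have "e x (e x v) = e x v" if "x \<in> Field r" "v \<in> obj N x" for x v
    using \<phi>_e[OF that] by (simp add: e_def)
  moreover have "\<exists>x\<in>Field r. \<exists>v\<in>obj N x. e x v \<noteq> 0"
  proof -
    obtain x a where x: "x \<in> Field r" and a: "a \<in> obj A x" "a \<noteq> 0"
      using A kmodule_zero_in[OF A(1)] unfolding zero_module_def by blast
    have w: "(a, 0) \<in> obj (dsum2 A B) x" using a kmodule_zero_in[OF B(1) x] by simp
    have "e x (\<psi> x (a, 0)) = \<psi> x (a, 0)" using inv(2)[OF x w] by (simp add: e_def)
    moreover have "\<psi> x (a, 0) \<noteq> 0"
      using inv(2)[OF x w] a(2) nat_trans_zero[OF \<phi> x kmodule_zero_in[OF N x]]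
      by (auto simp: zero_prod_def)
    ultimately show ?thesis using x nat_trans_in[OF \<psi> x w] by metis
  qed
  moreover have "\<exists>x\<in>Field r. \<exists>v\<in>obj N x. e x v \<noteq> v"
  proof -
    obtain x b where x: "x \<in> Field r" and b: "b \<in> obj B x" "b \<noteq> 0"
      using B kmodule_zero_in[OF B(1)] unfolding zero_module_def by blast
    have w: "(0, b) \<in> obj (dsum2 A B) x" using b kmodule_zero_in[OF A(1) x] by simp
    have "\<phi> x (e x (\<psi> x (0, b))) = (0, 0)"
      using \<phi>_e[OF x nat_trans_in[OF \<psi> x w]] inv(2)[OF x w] by simp
    then have "e x (\<psi> x (0, b)) \<noteq> \<psi> x (0, b)" using inv(2)[OF x w] b(2) by auto
    then show ?thesis using x nat_trans_in[OF \<psi> x w] by metis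
  qed
  ultimately show thesis using that e by blast
qed

lemma sum_dim_submodule_less:
  fixes N :: "('p, 'k::field, 'v::ab_group_add) kfunctor"
  assumes fin: "finite (Field r)" and N: "kmodule r N" and U: "kmodule r (submodule N U)"
    and le: "\<And>x. x \<in> Field r \<Longrightarrow> U x \<subseteq> obj N x" and ne: "\<exists>x\<in>Field r. U x \<noteq> obj N x"
  shows "(\<Sum>x\<in>Field r. vector_space.dim (smul N) (U x)) <
    (\<Sum>x\<in>Field r. vector_space.dim (smul N) (obj N x))"
proof -
  interpret vector_space "smul N" using N by (rule kmodule_vector_space)
  have "dim (U x) \<le> dim (obj N x)" "U x \<noteq> obj N x \<Longrightarrow> dim (U x) < dim (obj N x)"
    if x: "x \<in> Field r" for x
  proof -
    obtain B where "finite B" "obj N x = span B" using kmodule_finite_span[OF N x] by blast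
    then show "dim (U x) \<le> dim (obj N x)" "U x \<noteq> obj N x \<Longrightarrow> dim (U x) < dim (obj N x)"
      using dim_subspace_le[of B "U x" "obj N x"] kmodule_subspace[OF N x]
        kmodule_subspace[OF U x] le[OF x] by simp_all
  qed
  then show ?thesis using ne by (intro sum_strict_mono_ex1 fin) auto
qed

lemma sum_lessThan_append:
  fixes f g :: "nat \<Rightarrow> 'a::comm_monoid_add"
  shows "(\<Sum>i<m + n. if i < m then f i else g (i - m)) = (\<Sum>i<m. f i) + (\<Sum>i<n. g i)"
  by (induction n) (simp_all add: add.assoc)

text \<open>The projections of the two parts are precomposed with \<open>e\<close> and with its
  complement. The mixed composites vanish because \<open>e\<close> fixes its image and kills its
  kernel.\<close>

lemma biproduct_append:
  fixes N :: "('p, 'k::field, 'v::ab_group_add) kfunctor"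
  assumes N: "kmodule r N" and e: "nat_trans r N N e"
    and idem: "\<And>x v. x \<in> Field r \<Longrightarrow> v \<in> obj N x \<Longrightarrow> e x (e x v) = e x v"
    and b: "biproduct r (submodule N (\<lambda>x. e x ` obj N x)) m L \<iota> \<pi>"
    and b': "biproduct r (submodule N (\<lambda>x. {v \<in> obj N x. e x v = 0})) n L' \<iota>' \<pi>'"
  shows "biproduct r N (m + n) (\<lambda>i. if i < m then L i else L' (i - m))
    (\<lambda>i. if i < m then \<iota> i else \<iota>' (i - m))
    (\<lambda>i x v. if i < m then \<pi> i x (e x v) else \<pi>' (i - m) x (v - e x v))"
proof -
  let ?A = "submodule N (\<lambda>x. e x ` obj N x)" and ?B = "submodule N (\<lambda>x. {v \<in> obj N x. e x v = 0})"
  have e_in: "e x v \<in> obj N x" if "x \<in> Field r" "v \<in> obj N x" for x v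
    using nat_trans_in[OF e that] .
  have inA: "nat_trans r ?A N (\<lambda>x v. v)" and inB: "nat_trans r ?B N (\<lambda>x v. v)"
    by (rule nat_trans_from_submodule[OF nat_trans_id]; use e_in in blast)+
  have toA: "nat_trans r N ?A e"
    by (rule nat_trans_into_submodule[OF e]) auto
  have diff: "v - e x v \<in> obj N x" "e x (v - e x v) = 0" if "x \<in> Field r" "v \<in> obj N x" for x v
    using that nat_trans_diff[OF e N that e_in] kmodule_diff_in[OF N that(1) that(2) e_in]
    by (simp_all add: idem)
  have toB: "nat_trans r N ?B (\<lambda>x v. v - e x v)"
    by (rule nat_trans_into_submodule[OF nat_trans_minus[OF N nat_trans_id e]]) (simp add: diff)
  have k: "k - m < n" if "k < m + n" "\<not> k < m" for k using that by linarith
  have \<iota>: "nat_trans r (L i) ?A (\<iota> i)" and \<pi>: "nat_trans r ?A (L i) (\<pi> i)" if "i < m" for i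
    using b that by (simp_all add: biproduct_def)
  have \<iota>': "nat_trans r (L' i) ?B (\<iota>' i)" and \<pi>': "nat_trans r ?B (L' i) (\<pi>' i)" if "i < n" for i
    using b' that by (simp_all add: biproduct_def)
  have \<pi>0: "\<pi> i x 0 = 0" if "i < m" "x \<in> Field r" for i x
    by (rule nat_trans_zero[OF \<pi>[OF that(1)] that(2)])
      (use nat_trans_zero[OF e that(2)] kmodule_zero_in[OF N that(2)] in \<open>auto intro: rev_image_eqI\<close>)
  have \<pi>'0: "\<pi>' i x 0 = 0" if "i < n" "x \<in> Field r" for i x
    by (rule nat_trans_zero[OF \<pi>'[OF that(1)] that(2)])
      (use nat_trans_zero[OF e that(2)] kmodule_zero_in[OF N that(2)] in simp)
  show ?thesis
    unfolding biproduct_def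
  proof (intro conjI allI ballI impI)
    fix i assume i: "i < m + n"
    show "nat_trans r (if i < m then L i else L' (i - m)) N (if i < m then \<iota> i else \<iota>' (i - m))"
      using nat_trans_comp[OF \<iota> inA] nat_trans_comp[OF \<iota>'[OF k[OF i]] inB] by simp
    show "nat_trans r N (if i < m then L i else L' (i - m))
      (\<lambda>x v. if i < m then \<pi> i x (e x v) else \<pi>' (i - m) x (v - e x v))"
      using nat_trans_comp[OF toA \<pi>] nat_trans_comp[OF toB \<pi>'[OF k[OF i]]] by simp
    fix j x v
    assume j: "j < m + n" and x: "x \<in> Field r" and v: "v \<in> obj (if j < m then L j else L' (j - m)) x"
    show "(if i < m then \<pi> i x (e x ((if j < m then \<iota> j else \<iota>' (j - m)) x v))
        else \<pi>' (i - m) x ((if j < m then \<iota> j else \<iota>' (j - m)) x v -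
          e x ((if j < m then \<iota> j else \<iota>' (j - m)) x v))) = (if i = j then v else 0)"
    proof (cases "j < m")
      case True
      then have v: "v \<in> obj (L j) x" using v by simp
      have "\<iota> j x v \<in> e x ` obj N x" using nat_trans_in[OF \<iota>[OF True] x v] by simp
      then have "e x (\<iota> j x v) = \<iota> j x v" using idem[OF x] by auto
      moreover have "i < m \<Longrightarrow> \<pi> i x (\<iota> j x v) = (if i = j then v else 0)"
        using b True x v by (simp add: biproduct_def)
      ultimately show ?thesis using True \<pi>'0[OF k[OF i] x] by auto
    next
      case False
      then have v: "v \<in> obj (L' (j - m)) x" using v by simp
      have "e x (\<iota>' (j - m) x v) = 0" using nat_trans_in[OF \<iota>'[OF k[OF j False]] x v] by simp
      moreover have "\<not> i < m \<Longrightarrow> \<pi>' (i - m) x (\<iota>' (j - m) x v) = (if i - m = j - m then v else 0)"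
        using b' k[OF i] k[OF j False] x v by (simp add: biproduct_def)
      ultimately show ?thesis using False \<pi>0[OF _ x] by auto
    qed
  next
    fix x v assume x: "x \<in> Field r" and v: "v \<in> obj N x"
    have ev: "e x v = (\<Sum>i<m. \<iota> i x (\<pi> i x (e x v)))"
      using b x v by (simp add: biproduct_def)
    have dv: "v - e x v = (\<Sum>i<n. \<iota>' i x (\<pi>' i x (v - e x v)))"
      using b' x diff[OF x v] by (simp add: biproduct_def)
    have "v = (\<Sum>i<m. \<iota> i x (\<pi> i x (e x v))) + (\<Sum>i<n. \<iota>' i x (\<pi>' i x (v - e x v)))"
      using ev dv by (metis add.commute diff_add_cancel)
    also have "\<dots> = (\<Sum>i<m + n. if i < m then \<iota> i x (\<pi> i x (e x v))
        else \<iota>' (i - m) x (\<pi>' (i - m) x (v - e x v)))"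
      by (rule sum_lessThan_append[symmetric])
    also have "\<dots> = (\<Sum>i<m + n. (if i < m then \<iota> i else \<iota>' (i - m)) x
        (if i < m then \<pi> i x (e x v) else \<pi>' (i - m) x (v - e x v)))"
      by (intro sum.cong) auto
    finally show "v = (\<Sum>i<m + n. (if i < m then \<iota> i else \<iota>' (i - m)) x
        (if i < m then \<pi> i x (e x v) else \<pi>' (i - m) x (v - e x v)))" .
  qed
qed

text \<open>Induction on the sum of the dimensions over all elements of the poset: both the image
  and the kernel of a nontrivial idempotent have smaller total dimension. The clause on
  \<open>smul (L 0)\<close> covers an empty decomposition, where \<open>dsum\<close> still refers to
  \<open>L 0\<close>.\<close>

lemma exists_indecomposable_biproduct:
  fixes N :: "('p, 'k::field, 'v::ab_group_add) kfunctor"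
  assumes fin: "finite (Field r)" and "kmodule r N"
  shows "\<exists>n (L :: nat \<Rightarrow> ('p, 'k, 'v) kfunctor) \<iota> \<pi>.
    (\<forall>i<n. indecomposable r (L i)) \<and> (\<forall>a. smul (L 0) a 0 = 0) \<and> biproduct r N n L \<iota> \<pi>"
  using assms(2)
proof (induction "\<Sum>x\<in>Field r. vector_space.dim (smul N) (obj N x)" arbitrary: N rule: less_induct)
  case less
  note N = less.prems
  consider "zero_module r N" | "indecomposable r N" | "\<not> zero_module r N" "\<not> indecomposable r N"
    by blast
  then show ?case
  proof cases
    case 1
    then have "biproduct r N 0 (\<lambda>_. N) (\<lambda>_ x v. v) (\<lambda>_ x v. v)"
      by (simp add: biproduct_def zero_module_def)
    then show ?thesis
      using kmodule_smul_zero[OF N]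
      by (intro exI[of _ 0] exI[of _ "\<lambda>_. N"] exI[of _ "\<lambda>_ x v. v"]) auto
  next
    case 2
    have "biproduct r N 1 (\<lambda>_. N) (\<lambda>_ x v. v) (\<lambda>_ x v. v)"
      by (simp add: biproduct_def nat_trans_id)
    then show ?thesis
      using 2 kmodule_smul_zero[OF N]
      by (intro exI[of _ 1] exI[of _ "\<lambda>_. N"] exI[of _ "\<lambda>_ x v. v"]) auto
  next
    case 3
    obtain e where e: "nat_trans r N N e"
      and idem: "\<And>x v. x \<in> Field r \<Longrightarrow> v \<in> obj N x \<Longrightarrow> e x (e x v) = e x v"
      and ne: "\<exists>x\<in>Field r. \<exists>v\<in>obj N x. e x v \<noteq> 0" "\<exists>x\<in>Field r. \<exists>v\<in>obj N x. e x v \<noteq> v"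
      using split_of_not_indecomposable[OF N 3] by blast
    let ?A = "submodule N (\<lambda>x. e x ` obj N x)"
    let ?B = "submodule N (\<lambda>x. {v \<in> obj N x. e x v = 0})"
    have A: "kmodule r ?A" by (rule kmodule_image[OF N N e])
    have B: "kmodule r ?B"
      by (rule kmodule_ker[OF N e]) (simp_all add: kmodule_smul_zero[OF N] kmodule_mor_zero[OF N])
    \<comment> \<open>Since \<open>e\<close> is the identity on its image, a vector it moves
      witnesses that the image is proper.\<close>
    obtain x v where "x \<in> Field r" "v \<in> obj N x" "e x v \<noteq> v" using ne(2) by blast
    then have "v \<notin> e x ` obj N x" using idem by auto
    then have neA: "\<exists>x\<in>Field r. e x ` obj N x \<noteq> obj N x"
      using \<open>x \<in> Field r\<close> \<open>v \<in> obj N x\<close> by blast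
    have "(\<Sum>x\<in>Field r. vector_space.dim (smul ?A) (obj ?A x)) <
        (\<Sum>x\<in>Field r. vector_space.dim (smul N) (obj N x))"
      using sum_dim_submodule_less[OF fin N A _ neA] nat_trans_in[OF e] by (simp add: image_subset_iff)
    from less.hyps[OF this A] obtain m and L :: "nat \<Rightarrow> ('p, 'k, 'v) kfunctor" and \<iota> \<pi>
      where L: "\<forall>i<m. indecomposable r (L i)" "\<forall>a. smul (L 0) a 0 = 0" "biproduct r ?A m L \<iota> \<pi>"
      by (elim exE conjE) (rule that)
    have neB: "\<exists>x\<in>Field r. {v \<in> obj N x. e x v = 0} \<noteq> obj N x" using ne(1) by blast
    have "(\<Sum>x\<in>Field r. vector_space.dim (smul ?B) (obj ?B x)) <
        (\<Sum>x\<in>Field r. vector_space.dim (smul N) (obj N x))"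
      using sum_dim_submodule_less[OF fin N B _ neB] by auto
    from less.hyps[OF this B] obtain n and L' :: "nat \<Rightarrow> ('p, 'k, 'v) kfunctor" and \<iota>' \<pi>'
      where L': "\<forall>i<n. indecomposable r (L' i)" "\<forall>a. smul (L' 0) a 0 = 0" "biproduct r ?B n L' \<iota>' \<pi>'"
      by (elim exE conjE) (rule that)
    let ?L = "\<lambda>i. if i < m then L i else L' (i - m)"
    have "\<forall>i<m + n. indecomposable r (?L i)" using L(1) L'(1) by simp
    moreover have "\<forall>a. smul (?L 0) a 0 = 0" using L(2) L'(2) by simp
    moreover note biproduct_append[OF N e idem L(3) L'(3)]
    ultimately show ?thesis by (intro exI[of _ "m + n"] exI[of _ ?L] exI conjI) simp_all
  qed
qed

section \<open>Multiplicities of bricks\<close>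

text \<open>When \<open>L\<close> at \<open>x\<close> is the field, a morphism out of
  \<open>L\<close> enters the pairing only through the image of \<open>1\<close>, and one into
  \<open>L\<close> only through its component at \<open>x\<close>. Both are attached to the single
  space \<open>obj N x\<close>, so they can be compared literally over different posets.\<close>

definition hom_values ::
  "'p rel \<Rightarrow> ('p, 'k::field, 'k) kfunctor \<Rightarrow> 'p \<Rightarrow> ('p, 'k, 'v::ab_group_add) kfunctor \<Rightarrow> 'v set" where
  "hom_values r L x N = {f x 1 |f. nat_trans r L N f}"

definition hom_functionals ::
  "'p rel \<Rightarrow> ('p, 'k::field, 'k) kfunctor \<Rightarrow> 'p \<Rightarrow> ('p, 'k, 'v::ab_group_add) kfunctor \<Rightarrow> ('v \<Rightarrow> 'k) set" where
  "hom_functionals r L x N = {g x |g. nat_trans r N L g}"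

lemma hom_valuesI: "nat_trans r L N f \<Longrightarrow> v = f x 1 \<Longrightarrow> v \<in> hom_values r L x N"
  by (auto simp: hom_values_def)

lemma hom_functionalsI: "nat_trans r N L g \<Longrightarrow> \<delta> = g x \<Longrightarrow> \<delta> \<in> hom_functionals r L x N"
  by (auto simp: hom_functionals_def)

text \<open>The scalar of an endomorphism is read off at \<open>x0\<close>, where \<open>L\<close>
  is the field itself. Thus a composite of \<open>f\<close> and \<open>g\<close> through another
  module is multiplication by \<open>g x0 (f x0 1)\<close>.\<close>

locale brick =
  fixes r :: "'p rel" and L :: "('p, 'k::field, 'k) kfunctor" and x0 :: 'p
  assumes finite_Field: "finite (Field r)"
    and kmodule: "kmodule r L"
    and base: "x0 \<in> Field r"
    and smul_eq: "smul L = (*)"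
    and obj_base: "obj L x0 = UNIV"
    and endo: "nat_trans r L L h \<Longrightarrow> x \<in> Field r \<Longrightarrow> v \<in> obj L x \<Longrightarrow> h x v = h x0 1 * v"
begin

section \<open>Copies of a brick split off by a nonzero value of the pairing\<close>

lemma retraction:
  assumes f: "nat_trans r L K f" and g: "nat_trans r K L g" and ne: "g x0 (f x0 1) \<noteq> 0"
  obtains g' where "nat_trans r K L g'"
    "\<And>x v. x \<in> Field r \<Longrightarrow> v \<in> obj L x \<Longrightarrow> g' x (f x v) = v"
proof -
  let ?g = "\<lambda>x v. smul L (inverse (g x0 (f x0 1))) (g x v)"
  have "?g x (f x v) = v" if "x \<in> Field r" "v \<in> obj L x" for x v
    using endo[OF nat_trans_comp[OF f g] that] ne by (simp add: smul_eq)
  then show thesis using that nat_trans_scaled[OF kmodule g] by blast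
qed

lemma has_summand_of_pairing:
  assumes K: "kmodule r K" and fg: "nat_trans r L K f" "nat_trans r K L g" "g x0 (f x0 1) \<noteq> 0"
  shows "has_summand r K L"
proof -
  obtain g' where g': "nat_trans r K L g'"
    "\<And>x v. x \<in> Field r \<Longrightarrow> v \<in> obj L x \<Longrightarrow> g' x (f x v) = v"
    using retraction[OF fg] by blast
  have "kmodule r (submodule K (\<lambda>x. {v \<in> obj K x. g' x v = 0}))"
    by (rule kmodule_ker[OF K g'(1)])
      (simp_all add: kmodule_smul_zero[OF kmodule] kmodule_mor_zero[OF kmodule])
  then show ?thesis
    unfolding has_summand_def using isomorphic_dsum2_of_retract[OF K fg(1) g'] by blast
qed

text \<open>Indecomposability only tests summands with the ambient type of \<open>K\<close>, so the
  summand split off is the image of \<open>f\<close>, not \<open>L\<close> itself. It is nonzero at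
  \<open>x0\<close>, hence the complementary kernel of \<open>e\<close> is zero; as
  \<open>v - e x v\<close> lies in that kernel, \<open>f\<close> and \<open>g'\<close> are mutually
  inverse.\<close>

lemma isomorphic_of_pairing:
  assumes ind: "indecomposable r K"
    and fg: "nat_trans r L K f" "nat_trans r K L g" "g x0 (f x0 1) \<noteq> 0"
  shows "isomorphic r K L"
proof -
  have K: "kmodule r K" using ind by (simp add: indecomposable_def)
  obtain g' where g': "nat_trans r K L g'"
    "\<And>x v. x \<in> Field r \<Longrightarrow> v \<in> obj L x \<Longrightarrow> g' x (f x v) = v"
    using retraction[OF fg] by blast
  define e where "e = (\<lambda>x v. f x (g' x v))"
  have e: "nat_trans r K K e" unfolding e_def using nat_trans_comp[OF g'(1) fg(1)] .
  let ?A = "submodule K (\<lambda>x. f x ` obj L x)"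
  have A: "kmodule r ?A" by (rule kmodule_image[OF K kmodule fg(1)])
  have eA: "nat_trans r K ?A e"
    by (rule nat_trans_into_submodule[OF e]) (simp add: e_def nat_trans_in[OF g'(1)])
  have inc: "nat_trans r ?A K (\<lambda>x v. v)"
    by (rule nat_trans_from_submodule[OF nat_trans_id]) (auto simp: nat_trans_in[OF fg(1)])
  let ?B = "submodule K (\<lambda>x. {v \<in> obj K x. e x v = 0})"
  have B: "kmodule r ?B"
    by (rule kmodule_ker[OF K e]) (simp_all add: kmodule_smul_zero[OF K] kmodule_mor_zero[OF K])
  have "isomorphic r K (dsum2 ?A ?B)"
    by (rule isomorphic_dsum2_of_retract[OF K inc eA]) (auto simp: e_def g'(2))
  then have "zero_module r ?A \<or> zero_module r ?B"
    using ind A B unfolding indecomposable_def by blast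
  moreover have "f x0 1 \<noteq> 0"
    using fg(3) nat_trans_zero[OF fg(2) base kmodule_zero_in[OF K base]] by auto
  then have "\<not> zero_module r ?A"
    using base obj_base by (auto simp: zero_module_def intro!: bexI[of _ x0])
  ultimately have ker: "\<And>x v. x \<in> Field r \<Longrightarrow> v \<in> obj K x \<Longrightarrow> e x v = 0 \<Longrightarrow> v = 0"
    by (auto simp: zero_module_def)
  have "f x (g' x v) = v" if x: "x \<in> Field r" and v: "v \<in> obj K x" for x v
  proof -
    have ev: "e x v \<in> obj K x" using nat_trans_in[OF e x v] .
    have "e x (v - e x v) = e x v - e x (e x v)" by (rule nat_trans_diff[OF e K x v ev])
    also have "\<dots> = 0" using g'(2)[OF x nat_trans_in[OF g'(1) x v]] by (simp add: e_def)
    finally have "v - e x v = 0" using ker[OF x kmodule_diff_in[OF K x v ev]] by blast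
    then show ?thesis by (simp add: e_def)
  qed
  then show ?thesis unfolding isomorphic_def using fg(1) g' by blast
qed

text \<open>Each summand isomorphic to \<open>L\<close> contributes one vector, the image of
  \<open>1\<close> under its inclusion, and one functional, its projection followed by the
  isomorphism to \<open>L\<close>. The remaining summands have zero pairing and drop out of the
  expansion.\<close>

lemma dual_basis_of_indecomposables:
  assumes N: "kmodule r N" and b: "biproduct r N n K \<iota> \<pi>"
    and ind: "\<And>i. i < n \<Longrightarrow> indecomposable r (K i)"
  shows "\<exists>u \<gamma>. dual_basis (hom_values r L x0 N) (hom_functionals r L x0 N)
    {i. i < n \<and> isomorphic r (K i) L} u \<gamma>"
proof -
  let ?S = "{i. i < n \<and> isomorphic r (K i) L}"
  have K: "kmodule r (K i)" if "i < n" for i using ind[OF that] by (simp add: indecomposable_def)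
  have \<iota>: "nat_trans r (K i) N (\<iota> i)" and \<pi>: "nat_trans r N (K i) (\<pi> i)" if "i < n" for i
    using b that by (simp_all add: biproduct_def)
  have "\<forall>i\<in>?S. \<exists>\<phi> \<psi>. nat_trans r (K i) L \<phi> \<and> nat_trans r L (K i) \<psi> \<and>
      (\<forall>x\<in>Field r. (\<forall>v\<in>obj (K i) x. \<psi> x (\<phi> x v) = v) \<and> (\<forall>w\<in>obj L x. \<phi> x (\<psi> x w) = w))"
    by (simp add: isomorphic_def)
  from bchoice[OF this] obtain \<phi> where "\<forall>i\<in>?S. \<exists>\<psi>. nat_trans r (K i) L (\<phi> i) \<and>
      nat_trans r L (K i) \<psi> \<and> (\<forall>x\<in>Field r. (\<forall>v\<in>obj (K i) x. \<psi> x (\<phi> i x v) = v) \<and>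
        (\<forall>w\<in>obj L x. \<phi> i x (\<psi> x w) = w))" ..
  from bchoice[OF this] obtain \<psi> where iso: "\<forall>i\<in>?S. nat_trans r (K i) L (\<phi> i) \<and>
      nat_trans r L (K i) (\<psi> i) \<and> (\<forall>x\<in>Field r. (\<forall>v\<in>obj (K i) x. \<psi> i x (\<phi> i x v) = v) \<and>
        (\<forall>w\<in>obj L x. \<phi> i x (\<psi> i x w) = w))" ..
  have \<phi>: "nat_trans r (K i) L (\<phi> i)" and \<psi>: "nat_trans r L (K i) (\<psi> i)"
    and inv: "\<And>x v. x \<in> Field r \<Longrightarrow> v \<in> obj (K i) x \<Longrightarrow> \<psi> i x (\<phi> i x v) = v"
      "\<And>x w. x \<in> Field r \<Longrightarrow> w \<in> obj L x \<Longrightarrow> \<phi> i x (\<psi> i x w) = w" if "i \<in> ?S" for i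
    using bspec[OF iso that] by simp_all
  let ?u = "\<lambda>i. \<iota> i x0 (\<psi> i x0 1)" and ?\<gamma> = "\<lambda>i v. \<phi> i x0 (\<pi> i x0 v)"
  have one: "1 \<in> obj L x0" by (simp add: obj_base)
  have "dual_basis (hom_values r L x0 N) (hom_functionals r L x0 N) ?S ?u ?\<gamma>"
    unfolding dual_basis_def
  proof (intro conjI ballI subsetI)
    show "finite ?S" by simp
  next
    fix v assume "v \<in> ?u ` ?S"
    then obtain i where i: "i \<in> ?S" "v = ?u i" by blast
    then have "nat_trans r L N (\<lambda>x w. \<iota> i x (\<psi> i x w))" using nat_trans_comp[OF \<psi> \<iota>] by simp
    then show "v \<in> hom_values r L x0 N" using i(2) by (rule hom_valuesI)
  next
    fix \<delta> assume "\<delta> \<in> ?\<gamma> ` ?S"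
    then obtain i where i: "i \<in> ?S" "\<delta> = ?\<gamma> i" by blast
    then have "nat_trans r N L (\<lambda>x w. \<phi> i x (\<pi> i x w))" using nat_trans_comp[OF \<pi> \<phi>] by simp
    then show "\<delta> \<in> hom_functionals r L x0 N" using i(2) by (rule hom_functionalsI)
  next
    fix i j assume i: "i \<in> ?S" and j: "j \<in> ?S"
    have "\<pi> i x0 (\<iota> j x0 (\<psi> j x0 1)) = (if i = j then \<psi> j x0 1 else 0)"
      using b i j base nat_trans_in[OF \<psi>[OF j] base one] by (simp add: biproduct_def)
    then show "?\<gamma> i (?u j) = (if i = j then 1 else 0)"
      using inv(2)[OF j base one] nat_trans_zero[OF \<phi>[OF i] base kmodule_zero_in[OF K base]] i
      by simp
  next
    fix v \<delta> assume "v \<in> hom_values r L x0 N" "\<delta> \<in> hom_functionals r L x0 N"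
    then obtain f g where f: "nat_trans r L N f" "v = f x0 1" and g: "nat_trans r N L g" "\<delta> = g x0"
      unfolding hom_values_def hom_functionals_def by blast
    have v: "v \<in> obj N x0" using nat_trans_in[OF f(1) base one] f(2) by simp
    have "\<delta> v = \<delta> (\<Sum>i<n. \<iota> i x0 (\<pi> i x0 v))"
      using b base v by (simp add: biproduct_def)
    also have "\<dots> = (\<Sum>i<n. \<delta> (\<iota> i x0 (\<pi> i x0 v)))"
      unfolding g(2)
      by (rule nat_trans_sum[OF g(1) base])
        (use base v in \<open>auto simp: kmodule_zero_in[OF N] kmodule_add_in[OF N] nat_trans_in[OF \<iota>]
          nat_trans_in[OF \<pi>]\<close>)
    also have "\<dots> = (\<Sum>i\<in>?S. \<delta> (\<iota> i x0 (\<pi> i x0 v)))"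
    proof (rule sum.mono_neutral_right)
      show "\<forall>i\<in>{..<n} - ?S. \<delta> (\<iota> i x0 (\<pi> i x0 v)) = 0"
      proof
        fix i assume "i \<in> {..<n} - ?S"
        then have i: "i < n" "\<not> isomorphic r (K i) L" by auto
        then show "\<delta> (\<iota> i x0 (\<pi> i x0 v)) = 0"
          using isomorphic_of_pairing[OF ind[OF i(1)] nat_trans_comp[OF f(1) \<pi>[OF i(1)]]
              nat_trans_comp[OF \<iota>[OF i(1)] g(1)]] f(2) g(2) by blast
      qed
    qed auto
    also have "\<dots> = (\<Sum>i\<in>?S. \<delta> (?u i) * ?\<gamma> i v)"
    proof (rule sum.cong)
      fix i assume i: "i \<in> ?S"
      then have n: "i < n" by simp
      \<comment> \<open>\<open>?h\<close> is an endomorphism of \<open>L\<close> passing through the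
        \<open>i\<close>-th summand, hence a scalar; this separates the factor
        \<open>\<delta> (?u i)\<close> from \<open>?\<gamma> i v\<close>.\<close>
      let ?h = "\<lambda>x w. g x (\<iota> i x (\<psi> i x w))"
      have pv: "\<pi> i x0 v \<in> obj (K i) x0" using nat_trans_in[OF \<pi>[OF n] base v] .
      have "\<delta> (\<iota> i x0 (\<pi> i x0 v)) = ?h x0 (?\<gamma> i v)"
        using inv(1)[OF i base pv] by (simp add: g(2))
      also have "\<dots> = ?h x0 1 * ?\<gamma> i v"
        by (rule endo[OF nat_trans_comp[OF nat_trans_comp[OF \<psi>[OF i] \<iota>[OF n]] g(1)] base])
          (simp add: obj_base)
      finally show "\<delta> (\<iota> i x0 (\<pi> i x0 v)) = \<delta> (?u i) * ?\<gamma> i v" by (simp add: g(2))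
    qed simp
    finally show "\<delta> v = (\<Sum>i\<in>?S. \<delta> (?u i) * ?\<gamma> i v)" .
  qed
  then show ?thesis by blast
qed

lemma exists_dual_basis:
  fixes N :: "('p, 'k, 'v::ab_group_add) kfunctor"
  assumes "kmodule r N"
  shows "\<exists>(S :: nat set) u \<gamma>. dual_basis (hom_values r L x0 N) (hom_functionals r L x0 N) S u \<gamma>"
proof -
  obtain n and K :: "nat \<Rightarrow> ('p, 'k, 'v) kfunctor" and \<iota> \<pi>
    where "\<forall>i<n. indecomposable r (K i)" "biproduct r N n K \<iota> \<pi>"
    using exists_indecomposable_biproduct[OF finite_Field assms] by (elim exE conjE) (rule that)
  then have "\<exists>u \<gamma>. dual_basis (hom_values r L x0 N) (hom_functionals r L x0 N)
      {i. i < n \<and> isomorphic r (K i) L} u \<gamma>"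
    using dual_basis_of_indecomposables[OF assms] by blast
  then show ?thesis by blast
qed

text \<open>Every decomposition yields a dual basis of one and the same pairing. This gives the
  uniqueness that \<open>THE\<close> demands without matching the summands of two
  decompositions.\<close>

lemma mult_eq_card:
  fixes N :: "('p, 'k, 'v::ab_group_add) kfunctor"
  assumes N: "kmodule r N"
    and S: "dual_basis (hom_values r L x0 N) (hom_functionals r L x0 N) S u \<gamma>"
  shows "mult r N L = card S"
  unfolding mult_def
proof (rule the_equality)
  obtain n and K :: "nat \<Rightarrow> ('p, 'k, 'v) kfunctor" and \<iota> \<pi>
    where "\<forall>i<n. indecomposable r (K i)" "\<forall>a. smul (K 0) a 0 = 0"
      and b: "biproduct r N n K \<iota> \<pi>"
    using exists_indecomposable_biproduct[OF finite_Field N] by (elim exE conjE) (rule that)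
  then have K: "\<And>i. i < n \<Longrightarrow> indecomposable r (K i)" "\<And>a. smul (K 0) a 0 = 0" by blast+
  have "kmodule r (K i)" if "i < n" for i using K(1)[OF that] by (simp add: indecomposable_def)
  then have iso: "isomorphic r N (dsum n K)"
    using biproduct_isomorphic[where L = K, OF N _ K(2) b] by blast
  obtain w \<delta> where "dual_basis (hom_values r L x0 N) (hom_functionals r L x0 N)
      {i. i < n \<and> isomorphic r (K i) L} w \<delta>"
    using dual_basis_of_indecomposables[OF N b K(1)] by blast
  then have "card S = card {i. i < n \<and> isomorphic r (K i) L}"
    by (rule dual_basis_card_unique[OF S])
  then show "\<exists>n (K :: nat \<Rightarrow> ('p, 'k, 'v) kfunctor). (\<forall>i<n. indecomposable r (K i)) \<and>
      isomorphic r N (dsum n K) \<and> card S = card {i. i < n \<and> isomorphic r (K i) L}"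
    using K(1) iso by blast
next
  fix d assume "\<exists>n (K :: nat \<Rightarrow> ('p, 'k, 'v) kfunctor). (\<forall>i<n. indecomposable r (K i)) \<and>
      isomorphic r N (dsum n K) \<and> d = card {i. i < n \<and> isomorphic r (K i) L}"
  then obtain n and K :: "nat \<Rightarrow> ('p, 'k, 'v) kfunctor"
    where K: "\<And>i. i < n \<Longrightarrow> indecomposable r (K i)" and iso: "isomorphic r N (dsum n K)"
      and d: "d = card {i. i < n \<and> isomorphic r (K i) L}"
    by (elim exE conjE) (use that in blast)
  have "kmodule r (K i)" if "i < n" for i using K[OF that] by (simp add: indecomposable_def)
  then obtain \<iota> \<pi> where b: "biproduct r N n K \<iota> \<pi>"
    using isomorphic_biproduct[where L = K, OF _ iso] by blast
  obtain w \<delta> where "dual_basis (hom_values r L x0 N) (hom_functionals r L x0 N)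
      {i. i < n \<and> isomorphic r (K i) L} w \<delta>"
    using dual_basis_of_indecomposables[OF N b K] by blast
  then show "d = card S" using dual_basis_card_unique[OF S, of "{i. i < n \<and> isomorphic r (K i) L}"] d by simp
qed

text \<open>The coordinate inclusions and projections of the power of \<open>L\<close> are dual.
  They exhaust the pairing because a nonzero contribution through \<open>N'\<close> would split a
  copy of \<open>L\<close> off \<open>N'\<close>.\<close>

lemma dual_basis_of_mult_bar_decomposition:
  assumes N: "kmodule r N" and N': "kmodule r N'"
    and iso: "isomorphic r N (dsum2 (dsum d (\<lambda>_. L)) N')" and no: "\<not> has_summand r N' L"
  shows "\<exists>u \<gamma>. dual_basis (hom_values r L x0 N) (hom_functionals r L x0 N) {..<d} u \<gamma>"
proof -
  let ?D = "dsum d (\<lambda>_. L)"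
  obtain \<phi> \<psi> where \<phi>: "nat_trans r N (dsum2 ?D N') \<phi>" and \<psi>: "nat_trans r (dsum2 ?D N') N \<psi>"
    and inv: "\<And>x v. x \<in> Field r \<Longrightarrow> v \<in> obj N x \<Longrightarrow> \<psi> x (\<phi> x v) = v"
      "\<And>x w. x \<in> Field r \<Longrightarrow> w \<in> obj (dsum2 ?D N') x \<Longrightarrow> \<phi> x (\<psi> x w) = w"
    using iso unfolding isomorphic_def by blast
  have one: "1 \<in> obj L x0" by (simp add: obj_base)
  have \<psi>1: "nat_trans r ?D N (\<lambda>x w. \<psi> x (w, 0))"
    using nat_trans_comp[OF nat_trans_dsum2_left[OF kmodule_pointed[OF N']] \<psi>] .
  have "pointed r ?D" by (rule pointed_dsum) (simp_all add: kmodule kmodule_smul_zero[OF kmodule])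
  then have \<psi>2: "nat_trans r N' N (\<lambda>x w. \<psi> x (0, w))"
    using nat_trans_comp[OF nat_trans_dsum2_right \<psi>] by blast
  have \<phi>1: "nat_trans r N L (\<lambda>x v. fst (\<phi> x v) i)" if "i < d" for i
    using nat_trans_comp[OF nat_trans_comp[OF \<phi> nat_trans_dsum2_fst] nat_trans_dsum_proj[OF that]] .
  have inj: "nat_trans r L ?D (\<lambda>x v j. if j = i then v else 0)" if "i < d" for i
    using nat_trans_dsum_inj[where L = "\<lambda>_. L", OF kmodule that] .
  have \<psi>i: "nat_trans r L N (\<lambda>x v. \<psi> x ((\<lambda>j. if j = i then v else 0), 0))" if "i < d" for i
    using nat_trans_comp[OF inj[OF that] \<psi>1] .
  let ?u = "\<lambda>i. \<psi> x0 ((\<lambda>j. if j = i then 1 else 0), 0)" and ?\<gamma> = "\<lambda>i v. fst (\<phi> x0 v) i"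
  have "dual_basis (hom_values r L x0 N) (hom_functionals r L x0 N) {..<d} ?u ?\<gamma>"
    unfolding dual_basis_def
  proof (intro conjI ballI)
    show "?u ` {..<d} \<subseteq> hom_values r L x0 N" using hom_valuesI[OF \<psi>i] by blast
    show "?\<gamma> ` {..<d} \<subseteq> hom_functionals r L x0 N" using hom_functionalsI[OF \<phi>1] by blast
  next
    fix i j assume "i \<in> {..<d}" "j \<in> {..<d}"
    moreover from this have "((\<lambda>i. if i = j then 1 else 0), 0) \<in> obj (dsum2 ?D N') x0"
      using nat_trans_in[OF inj base one] kmodule_zero_in[OF N' base] by simp
    ultimately show "?\<gamma> i (?u j) = (if i = j then 1 else 0)" using inv(2)[OF base] by simp
  next
    fix v \<delta> assume "v \<in> hom_values r L x0 N" "\<delta> \<in> hom_functionals r L x0 N"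
    then obtain f g where f: "nat_trans r L N f" "v = f x0 1" and g: "nat_trans r N L g" "\<delta> = g x0"
      unfolding hom_values_def hom_functionals_def by blast
    have v: "v \<in> obj N x0" using nat_trans_in[OF f(1) base one] f(2) by simp
    obtain w z where wz: "\<phi> x0 v = (w, z)" by fastforce
    have w: "w \<in> obj ?D x0" and z: "z \<in> obj N' x0"
      using nat_trans_in[OF \<phi> base v] wz by auto
    \<comment> \<open>This is the value at \<open>1\<close> of the composite from \<open>L\<close>
      through \<open>N'\<close> back to \<open>L\<close>; were it nonzero, \<open>L\<close> would be
      a summand of \<open>N'\<close>.\<close>
    have gz: "\<delta> (\<psi> x0 (0, z)) = 0"
      using has_summand_of_pairing[OF N' nat_trans_comp[OF nat_trans_comp[OF f(1) \<phi>] nat_trans_dsum2_snd]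
          nat_trans_comp[OF \<psi>2 g(1)]] no f(2) g(2) wz by auto
    have "\<psi> x0 (\<phi> x0 v) = \<psi> x0 ((w, 0) + (0, z))" by (simp add: wz)
    also have "\<dots> = \<psi> x0 (w, 0) + \<psi> x0 (0, z)"
      by (rule nat_trans_add[OF \<psi> base])
        (use w z in \<open>auto simp: kmodule_zero_in[OF N' base] kmodule_zero_in[OF kmodule base]\<close>)
    finally have "v = \<psi> x0 (w, 0) + \<psi> x0 (0, z)" using inv(1)[OF base v] by simp
    then have "\<delta> v = \<delta> (\<psi> x0 (w, 0))"
      using nat_trans_add[OF g(1) base nat_trans_in[OF \<psi>1 base w] nat_trans_in[OF \<psi>2 base z]] gz
      by (simp add: g(2))
    also have "\<dots> = (\<Sum>i<d. \<delta> (\<psi> x0 ((\<lambda>j. if j = i then w i else 0), 0)))"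
      unfolding g(2) by (rule nat_trans_dsum_expand[OF kmodule nat_trans_comp[OF \<psi>1 g(1)] base w])
    also have "\<dots> = (\<Sum>i<d. \<delta> (?u i) * w i)"
      unfolding g(2) by (intro sum.cong refl endo[OF nat_trans_comp[OF \<psi>i g(1)] base])
        (auto simp: obj_base)
    finally show "\<delta> v = (\<Sum>i<d. \<delta> (?u i) * ?\<gamma> i v)" by (simp add: wz)
  qed simp
  then show ?thesis by blast
qed

text \<open>The dual families assemble to \<open>F\<close> from the power of \<open>L\<close> to
  \<open>N\<close> and \<open>G\<close> back, and duality makes \<open>F\<close> a section of
  \<open>G\<close>. The complement is the kernel of \<open>G\<close>. A copy of \<open>L\<close> in
  it would yield a vector killed by every \<open>\<gamma> i\<close> and a functional with value
  \<open>1\<close> on it, contradicting the expansion.\<close>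

lemma exists_mult_bar_decomposition:
  fixes N :: "('p, 'k, 'v::ab_group_add) kfunctor"
  assumes N: "kmodule r N"
    and S: "dual_basis (hom_values r L x0 N) (hom_functionals r L x0 N) {..<d} u \<gamma>"
  shows "\<exists>N' :: ('p, 'k, 'v) kfunctor. kmodule r N' \<and>
    isomorphic r N (dsum2 (dsum d (\<lambda>_. L)) N') \<and> \<not> has_summand r N' L"
proof -
  let ?D = "dsum d (\<lambda>_. L)"
  have one: "1 \<in> obj L x0" by (simp add: obj_base)
  have "\<exists>f. i < d \<longrightarrow> nat_trans r L N f \<and> u i = f x0 1" for i
    using S unfolding dual_basis_def hom_values_def by blast
  then obtain f where "\<And>i. i < d \<longrightarrow> nat_trans r L N (f i) \<and> u i = f i x0 1" by metis
  then have f: "nat_trans r L N (f i)" "u i = f i x0 1" if "i < d" for i using that by blast+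
  have "\<exists>g. i < d \<longrightarrow> nat_trans r N L g \<and> \<gamma> i = g x0" for i
    using S unfolding dual_basis_def hom_functionals_def by blast
  then obtain g where "\<And>i. i < d \<longrightarrow> nat_trans r N L (g i) \<and> \<gamma> i = g i x0" by metis
  then have g: "nat_trans r N L (g i)" "\<gamma> i = g i x0" if "i < d" for i using that by blast+
  define F where "F = (\<lambda>x w. \<Sum>i<d. f i x (w i))"
  define G where "G = (\<lambda>x v i. if i < d then g i x v else 0)"
  have F: "nat_trans r ?D N F"
    unfolding F_def using nat_trans_from_dsum[where L = "\<lambda>_. L" and \<iota> = f, OF N f(1)] .
  have G: "nat_trans r N ?D G"
    unfolding G_def
    using nat_trans_to_dsum[where L = "\<lambda>_. L" and \<pi> = g, OF kmodule_smul_zero[OF kmodule] g(1)] .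
  have GF: "G x (F x w) = w" if x: "x \<in> Field r" and w: "w \<in> obj ?D x" for x w
  proof
    fix i
    have "g i x (F x w) = w i" if i: "i < d"
    proof -
      have "g i x (F x w) = (\<Sum>j<d. g i x (f j x (w j)))"
        unfolding F_def
        by (rule nat_trans_sum[OF g(1)[OF i] x])
          (use w x in \<open>auto simp: kmodule_zero_in[OF N] kmodule_add_in[OF N] nat_trans_in[OF f(1)]\<close>)
      \<comment> \<open>Duality is known only at \<open>x0\<close>; the brick property carries the
        scalar \<open>\<gamma> i (u j)\<close> to every other element.\<close>
      also have "\<dots> = (\<Sum>j<d. \<gamma> i (u j) * w j)"
      proof (intro sum.cong refl)
        fix j assume "j \<in> {..<d}"
        then have j: "j < d" by simp
        then have "w j \<in> obj L x" using w by simp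
        then show "g i x (f j x (w j)) = \<gamma> i (u j) * w j"
          using endo[OF nat_trans_comp[OF f(1)[OF j] g(1)[OF i]] x] f(2)[OF j] g(2)[OF i] by simp
      qed
      also have "\<dots> = (\<Sum>j<d. if i = j then w j else 0)"
        using S i by (intro sum.cong) (auto simp: dual_basis_def)
      finally show ?thesis using i by simp
    qed
    then show "G x (F x w) i = w i" using w by (auto simp: G_def)
  qed
  let ?N = "submodule N (\<lambda>x. {v \<in> obj N x. G x v = 0})"
  have pD: "pointed r ?D" by (rule pointed_dsum) (simp_all add: kmodule kmodule_smul_zero[OF kmodule])
  have N': "kmodule r ?N"
    by (rule kmodule_ker[OF N G]) (use pD in \<open>auto simp only: pointed_def\<close>)
  have iso: "isomorphic r N (dsum2 ?D ?N)" by (rule isomorphic_dsum2_of_retract[OF N F G GF])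
  have "\<not> has_summand r ?N L"
  proof
    assume "has_summand r ?N L"
    then obtain N'' :: "('p, 'k, 'v) kfunctor" and \<phi> \<psi> where N'': "kmodule r N''"
      and \<phi>: "nat_trans r ?N (dsum2 L N'') \<phi>" and \<psi>: "nat_trans r (dsum2 L N'') ?N \<psi>"
      and inv: "\<And>x w. x \<in> Field r \<Longrightarrow> w \<in> obj (dsum2 L N'') x \<Longrightarrow> \<phi> x (\<psi> x w) = w"
      unfolding has_summand_def isomorphic_def by blast
    have \<psi>1: "nat_trans r L ?N (\<lambda>x v. \<psi> x (v, 0))"
      using nat_trans_comp[OF nat_trans_dsum2_left[OF kmodule_pointed[OF N'']] \<psi>] .
    have \<phi>1: "nat_trans r ?N L (\<lambda>x v. fst (\<phi> x v))" using nat_trans_comp[OF \<phi> nat_trans_dsum2_fst] .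
    have FG: "nat_trans r N N (\<lambda>x v. F x (G x v))" using nat_trans_comp[OF G F] .
    \<comment> \<open>The projection onto the complement extends a morphism from the complement to
      \<open>L\<close> to one defined on all of \<open>N\<close>.\<close>
    have pr: "nat_trans r N ?N (\<lambda>x v. v - F x (G x v))"
    proof (rule nat_trans_into_submodule[OF nat_trans_minus[OF N nat_trans_id FG]])
      fix x v assume x: "x \<in> Field r" and v: "v \<in> obj N x"
      have Gv: "G x v \<in> obj ?D x" using nat_trans_in[OF G x v] .
      have FGv: "F x (G x v) \<in> obj N x" using nat_trans_in[OF F x Gv] .
      show "v - F x (G x v) \<in> {v \<in> obj N x. G x v = 0}"
        using kmodule_diff_in[OF N x v FGv] nat_trans_diff[OF G N x v FGv] GF[OF x Gv] by simp
    qed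
    define v where "v = \<psi> x0 (1, 0)"
    have vN: "v \<in> obj N x0" and Gv: "G x0 v = 0"
      using nat_trans_in[OF \<psi>1 base one] by (auto simp: v_def)
    define \<delta> where "\<delta> = (\<lambda>v. fst (\<phi> x0 (v - F x0 (G x0 v))))"
    have inc: "nat_trans r ?N N (\<lambda>x v. v)" by (rule nat_trans_from_submodule[OF nat_trans_id]) auto
    have "v \<in> hom_values r L x0 N"
      by (rule hom_valuesI[OF nat_trans_comp[OF \<psi>1 inc] v_def])
    moreover have "\<delta> \<in> hom_functionals r L x0 N"
      by (rule hom_functionalsI[OF nat_trans_comp[OF pr \<phi>1] \<delta>_def])
    ultimately have "\<delta> v = (\<Sum>i<d. \<delta> (u i) * \<gamma> i v)" using S by (auto simp: dual_basis_def)
    also have "\<dots> = 0"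
    proof (intro sum.neutral ballI)
      fix i assume "i \<in> {..<d}"
      then show "\<delta> (u i) * \<gamma> i v = 0" using fun_cong[OF Gv, of i] g(2) by (simp add: G_def)
    qed
    finally have "\<delta> v = 0" .
    moreover have "F x0 0 = 0" using nat_trans_zero[OF F base] pD base by (auto simp: pointed_def)
    then have "\<delta> v = 1"
      using inv[OF base, of "(1, 0)"] one kmodule_zero_in[OF N'' base]
      by (simp add: \<delta>_def Gv) (simp add: v_def)
    ultimately show False by simp
  qed
  then show ?thesis using N' iso by blast
qed

lemma mult_bar_eq_card:
  fixes N :: "('p, 'k, 'v::ab_group_add) kfunctor"
  assumes N: "kmodule r N"
    and S: "dual_basis (hom_values r L x0 N) (hom_functionals r L x0 N) S u \<gamma>"
  shows "mult_bar r N L = card S"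
  unfolding mult_bar_def
proof (rule the_equality)
  show "\<exists>N' :: ('p, 'k, 'v) kfunctor. kmodule r N' \<and>
      isomorphic r N (dsum2 (dsum (card S) (\<lambda>_. L)) N') \<and> \<not> has_summand r N' L"
    using dual_basis_reindex[OF S] exists_mult_bar_decomposition[OF N] by blast
next
  fix d assume "\<exists>N' :: ('p, 'k, 'v) kfunctor. kmodule r N' \<and>
      isomorphic r N (dsum2 (dsum d (\<lambda>_. L)) N') \<and> \<not> has_summand r N' L"
  then obtain w \<delta> where
    "dual_basis (hom_values r L x0 N) (hom_functionals r L x0 N) {..<d} w \<delta>"
    using dual_basis_of_mult_bar_decomposition[OF N] by blast
  then show "d = card S" using dual_basis_card_unique[OF S] by fastforce
qed

end

section \<open>Interval modules and restriction\<close>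

lemma vector_space_mult: "vector_space ((*) :: 'k::field \<Rightarrow> 'k \<Rightarrow> 'k)"
  by unfold_locales (auto simp: algebra_simps)

lemma interval_module_simps [simp]:
  "smul (interval_module I) = (*)"
  "obj (interval_module I) = (\<lambda>x. if x \<in> I then UNIV else {0})"
  "mor (interval_module I) x y c v = (if x \<in> I \<and> y \<in> I then c * v else 0)"
  by (simp_all add: interval_module_def)

lemma restriction_simps [simp]:
  "smul (restriction f M) = smul M"
  "obj (restriction f M) x = obj M (f x)"
  "mor (restriction f M) x y c = mor M (f x) (f y) c"
  by (simp_all add: restriction_def)

lemma restriction_interval_module:
  "restriction f (interval_module I) = interval_module (f -` I)"
  by (simp add: restriction_def interval_module_def)

lemma kmodule_interval_module:
  assumes convex: "\<And>x y z. x \<in> I \<Longrightarrow> z \<in> I \<Longrightarrow> (x, y) \<in> r \<Longrightarrow> (y, z) \<in> r \<Longrightarrow> y \<in> I"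
  shows "kmodule r (interval_module I :: ('p, 'k::field, 'k) kfunctor)"
proof -
  let ?L = "interval_module I :: ('p, 'k, 'k) kfunctor"
  have id: "mor ?L x x 1 v = v" if "v \<in> obj ?L x" for x v
    using that by (cases "x \<in> I") simp_all
  have comp: "mor ?L x z (d * c) v = mor ?L y z d (mor ?L x y c v)"
    if "c \<in> lin_hom r x y" "d \<in> lin_hom r y z" for x y z and c d v :: 'k
  \<comment> \<open>In this case the composite through \<open>y\<close> is zero, so the direct map
    has to vanish as well: by convexity one of the two arrows does not exist, which forces its
    scalar to be zero.\<close>
  proof (cases "x \<in> I \<and> z \<in> I \<and> y \<notin> I")
    case True
    then have "(x, y) \<notin> r \<or> (y, z) \<notin> r" using convex by blast
    then have "c = 0 \<or> d = 0" using that by (auto simp: lin_hom_def)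
    then show ?thesis by auto
  qed auto
  have lin: "linear_between (smul ?L) (smul ?L) (obj ?L x) (obj ?L y) (mor ?L x y c)" for x y c
    by (simp add: linear_between_def algebra_simps)
  have scalar: "mor ?L x y (c + d) v = mor ?L x y c v + mor ?L x y d v"
    "mor ?L x y (a * c) v = smul ?L a (mor ?L x y c v)" for x y a c d v
    by (simp_all add: algebra_simps)
  note mult = vector_space_module[OF vector_space_mult[where 'k = 'k]]
  have sub: "module.subspace (*) {0 :: 'k}" "module.subspace (*) (UNIV :: 'k set)"
    by (auto intro!: module.subspaceI[OF mult])
  have "v \<in> module.span (*) {1}" for v :: 'k
    using module.span_scale[OF mult module.span_base[OF mult, of 1 "{1}"], of v] by simp
  then have fin: "\<exists>B :: 'k set. finite B \<and> UNIV = module.span (*) B"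
    by (intro exI[of _ "{1}"]) auto
  have fin0: "\<exists>B :: 'k set. finite B \<and> {0} = module.span (*) B"
    by (intro exI[of _ "{}"]) (simp add: module.span_empty[OF mult])
  show ?thesis
    unfolding kmodule_def
  proof (intro conjI ballI allI)
    show "vector_space (smul ?L)" unfolding interval_module_simps by (rule vector_space_mult)
    show "module.subspace (smul ?L) (obj ?L x)" for x using sub by simp
    show "\<exists>B. finite B \<and> obj ?L x = module.span (smul ?L) B" for x
      using fin fin0 by simp
  qed (rule lin id comp scalar; assumption)+
qed

text \<open>Inside \<open>I\<close> the structure map from \<open>x\<close> to the greatest element
  \<open>x0\<close> is the identity of the field, so naturality along it determines
  \<open>h x\<close> from \<open>h x0\<close>.\<close>

lemma brick_interval_module:
  assumes "finite (Field r)" and "I \<subseteq> Field r" and x0: "x0 \<in> I"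
    and top: "\<And>x. x \<in> I \<Longrightarrow> (x, x0) \<in> r"
    and convex: "\<And>x y z. x \<in> I \<Longrightarrow> z \<in> I \<Longrightarrow> (x, y) \<in> r \<Longrightarrow> (y, z) \<in> r \<Longrightarrow> y \<in> I"
  shows "brick r (interval_module I :: ('p, 'k::field, 'k) kfunctor) x0"
proof
  let ?L = "interval_module I :: ('p, 'k, 'k) kfunctor"
  show "kmodule r ?L" by (rule kmodule_interval_module[OF convex])
  show x0_in: "x0 \<in> Field r" using assms(2) x0 by blast
  fix h x and v :: 'k
  assume h: "nat_trans r ?L ?L h" and x: "x \<in> Field r" and v: "v \<in> obj ?L x"
  show "h x v = h x0 1 * v"
  proof (cases "x \<in> I")
    case True
    have "h x0 (mor ?L x x0 1 v) = mor ?L x x0 1 (h x v)"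
      using top[OF True] by (intro nat_trans_mor[OF h x x0_in _ v]) (simp add: lin_hom_def)
    then have "h x v = h x0 (smul ?L v 1)" using True x0 by simp
    also have "\<dots> = smul ?L v (h x0 1)"
      using x0 by (intro nat_trans_smul[OF h x0_in]) simp
    finally show ?thesis by simp
  next
    case False
    then show ?thesis using nat_trans_in[OF h x v] v by simp
  qed
qed (simp_all add: assms(1) x0)

lemma nat_trans_restriction:
  fixes M :: "('p, 'k::field, 'v::ab_group_add) kfunctor"
  assumes \<phi>: "nat_trans r M N \<phi>" and f: "\<And>x. x \<in> Field s \<Longrightarrow> f x \<in> Field r"
    and mono: "\<And>x y. (x, y) \<in> s \<Longrightarrow> (f x, f y) \<in> r"
  shows "nat_trans s (restriction f M) (restriction f N) (\<lambda>x. \<phi> (f x))"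
proof (rule nat_transI)
  fix x y v and c :: 'k
  assume "x \<in> Field s" "y \<in> Field s" "c \<in> lin_hom s x y" "v \<in> obj (restriction f M) x"
  then show "\<phi> (f y) (mor (restriction f M) x y c v) = mor (restriction f N) x y c (\<phi> (f x) v)"
    using f mono by (auto intro!: nat_trans_mor[OF \<phi>] simp: lin_hom_def)
qed (use f \<phi> in \<open>auto simp: nat_trans_in nat_trans_add nat_trans_smul\<close>)

lemma kmodule_restriction:
  fixes M :: "('p, 'k::field, 'v::ab_group_add) kfunctor"
  assumes M: "kmodule r M" and f: "\<And>x. x \<in> Field s \<Longrightarrow> f x \<in> Field r"
    and mono: "\<And>x y. (x, y) \<in> s \<Longrightarrow> (f x, f y) \<in> r"
  shows "kmodule s (restriction f M)"
proof -
  have lin: "c \<in> lin_hom r (f x) (f y)" if "c \<in> lin_hom s x y" for x y and c :: 'k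
    using that mono by (auto simp: lin_hom_def)
  have scalar: "mor M (f x) (f y) (c + d) v = mor M (f x) (f y) c v + mor M (f x) (f y) d v"
    if "x \<in> Field s" "y \<in> Field s" "c \<in> lin_hom s x y" "d \<in> lin_hom s x y" "v \<in> obj M (f x)"
    for x y c d v
    using M that(5) f[OF that(1)] f[OF that(2)] lin[OF that(3)] lin[OF that(4)]
    by (simp add: kmodule_def)
  have unit: "mor M (f x) (f x) 1 v = v" if "x \<in> Field s" "v \<in> obj M (f x)" for x v
    using M that(2) f[OF that(1)] by (simp add: kmodule_def)
  show ?thesis
    unfolding kmodule_def restriction_simps
    by (intro conjI ballI allI)
      (simp_all add: kmodule_vector_space[OF M] kmodule_subspace[OF M] kmodule_finite_span[OF M]
        kmodule_linear_between[OF M] kmodule_mor_comp[OF M] kmodule_mor_scalar[OF M] f lin scalar unit)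
qed

section \<open>The bipath poset and the poset \<open>Z\<close>\<close>

definition bipath_edges :: "nat \<Rightarrow> nat \<Rightarrow> node rel" where
  "bipath_edges n m =
     {(ZeroHat, Up 1)} \<union> {(Up i, Up (i + 1)) |i. 1 \<le> i \<and> i < n} \<union> {(Up n, OneHat)} \<union>
     {(ZeroHat, Dn 1)} \<union> {(Dn i, Dn (i + 1)) |i. 1 \<le> i \<and> i < m} \<union> {(Dn m, OneHat)}"

definition Z_edges :: "nat \<Rightarrow> nat \<Rightarrow> node rel" where
  "Z_edges n m =
     {(ZeroBar, Up 1)} \<union> {(Up i, Up (i + 1)) |i. 1 \<le> i \<and> i < n} \<union> {(Up n, OneHat)} \<union>
     {(ZeroHat, Dn 1)} \<union> {(Dn i, Dn (i + 1)) |i. 1 \<le> i \<and> i < m} \<union> {(Dn m, OneHat)}"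

lemma bipath_eq: "bipath n m = Restr ((bipath_edges n m)\<^sup>*) (bipath_set n m)"
  by (simp add: bipath_def bipath_edges_def)

lemma Zposet_eq: "Zposet n m = Restr ((Z_edges n m)\<^sup>*) (insert ZeroBar (bipath_set n m))"
  by (simp add: Zposet_def Z_edges_def)

lemma Field_Restr_rtrancl: "Field (Restr (E\<^sup>*) A) = A"
  by (auto simp: Field_def)

lemma Field_bipath [simp]: "Field (bipath n m) = bipath_set n m"
  by (simp add: bipath_eq Field_Restr_rtrancl)

lemma Field_Zposet [simp]: "Field (Zposet n m) = insert ZeroBar (bipath_set n m)"
  by (simp only: Zposet_eq Field_Restr_rtrancl)

lemma finite_bipath_set: "finite (bipath_set n m)"
  by (simp add: bipath_set_def)

lemma bipath_refl: "x \<in> bipath_set n m \<Longrightarrow> (x, x) \<in> bipath n m"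
  by (simp add: bipath_eq)

lemma bipath_trans: "(x, y) \<in> bipath n m \<Longrightarrow> (y, z) \<in> bipath n m \<Longrightarrow> (x, z) \<in> bipath n m"
  by (auto simp: bipath_eq)

lemma bipath_in: "(x, y) \<in> bipath n m \<Longrightarrow> x \<in> bipath_set n m \<and> y \<in> bipath_set n m"
  by (simp add: bipath_eq)

section \<open>Comparison of the two orders along \<open>zeta\<close>\<close>

lemma zeta_bipath_set: "x \<in> bipath_set n m \<Longrightarrow> zeta x = x"
  by (auto simp: bipath_set_def zeta_def)

lemma zeta_in: "x \<in> insert ZeroBar (bipath_set n m) \<Longrightarrow> zeta x \<in> bipath_set n m"
  by (auto simp: bipath_set_def zeta_def)

lemma zeta_mono: "(x, y) \<in> Zposet n m \<Longrightarrow> (zeta x, zeta y) \<in> bipath n m"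
proof -
  assume xy: "(x, y) \<in> Zposet n m"
  then have "(x, y) \<in> (Z_edges n m)\<^sup>*" unfolding Zposet_eq by blast
  then have "(zeta x, zeta y) \<in> (bipath_edges n m)\<^sup>*"
  proof (induction rule: rtrancl_induct)
    case (step y z)
    then have "(zeta y, zeta z) \<in> bipath_edges n m"
      by (auto simp: Z_edges_def bipath_edges_def zeta_def)
    then show ?case using step by simp
  qed simp
  moreover have "x \<in> insert ZeroBar (bipath_set n m)" "y \<in> insert ZeroBar (bipath_set n m)"
    using xy unfolding Zposet_eq by blast+
  ultimately show "(zeta x, zeta y) \<in> bipath n m"
    using zeta_in by (simp add: bipath_eq)
qed

lemma bipath_edges_not_ZeroHat:
  "(x, y) \<in> bipath_edges n m \<Longrightarrow> y \<noteq> ZeroHat"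
  "(x, y) \<in> bipath_edges n m \<Longrightarrow> x \<noteq> ZeroHat \<Longrightarrow> (x, y) \<in> Z_edges n m"
  by (auto simp: Z_edges_def bipath_edges_def)

text \<open>No edge enters \<open>ZeroHat\<close>, so a path starting elsewhere never meets it, and
  all edges with another source belong to both posets.\<close>

lemma Z_edges_path:
  "(x, y) \<in> (bipath_edges n m)\<^sup>* \<Longrightarrow> x \<noteq> ZeroHat \<Longrightarrow> (x, y) \<in> (Z_edges n m)\<^sup>*"
proof (induction rule: converse_rtrancl_induct)
  case (step x y)
  then show ?case
    using bipath_edges_not_ZeroHat by (metis converse_rtrancl_into_rtrancl)
qed simp

lemma bipath_imp_Zposet: "(x, y) \<in> bipath n m \<Longrightarrow> x \<noteq> ZeroHat \<Longrightarrow> (x, y) \<in> Zposet n m"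
  using Z_edges_path by (auto simp: bipath_eq Zposet_eq)

text \<open>The first edge of a nontrivial path leads to \<open>Up 1\<close> or \<open>Dn 1\<close>;
  in \<open>Z\<close> the former edge starts at \<open>ZeroBar\<close>, the latter at
  \<open>ZeroHat\<close>.\<close>

lemma bipath_from_ZeroHat:
  assumes "(ZeroHat, y) \<in> bipath n m"
  shows "(ZeroHat, y) \<in> Zposet n m \<or> (ZeroBar, y) \<in> Zposet n m"
proof -
  have y: "(ZeroHat, y) \<in> (bipath_edges n m)\<^sup>*" "ZeroHat \<in> bipath_set n m" "y \<in> bipath_set n m"
    using assms by (auto simp: bipath_eq)
  from y(1) have "(ZeroHat, y) \<in> (Z_edges n m)\<^sup>* \<or> (ZeroBar, y) \<in> (Z_edges n m)\<^sup>*"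
  proof (cases rule: converse_rtranclE)
    case (step z)
    have "(ZeroHat, z) \<in> Z_edges n m \<or> (ZeroBar, z) \<in> Z_edges n m"
      using step(1) by (auto simp: Z_edges_def bipath_edges_def)
    moreover have "(z, y) \<in> (Z_edges n m)\<^sup>*"
      using Z_edges_path[OF step(2)] bipath_edges_not_ZeroHat(1)[OF step(1)] by blast
    ultimately show ?thesis by (blast intro: converse_rtrancl_into_rtrancl)
  qed simp
  then show ?thesis using y(2,3) by (auto simp: Zposet_eq)
qed

lemma bipath_to_ZeroHat: "(x, ZeroHat) \<in> bipath n m \<Longrightarrow> x = ZeroHat"
proof -
  assume "(x, ZeroHat) \<in> bipath n m"
  then have "(x, ZeroHat) \<in> (bipath_edges n m)\<^sup>*" by (simp add: bipath_eq)
  then show "x = ZeroHat" by (cases rule: rtranclE) (use bipath_edges_not_ZeroHat(1) in auto)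
qed

section \<open>Comparabilities along the two paths\<close>

lemma Z_edges_Up:
  assumes "1 \<le> i" "i \<le> n" shows "(Up i, OneHat) \<in> (Z_edges n m)\<^sup>*"
  using assms(2,1)
proof (induction rule: inc_induct)
  case base
  have "(Up n, OneHat) \<in> Z_edges n m" by (simp add: Z_edges_def)
  then show ?case by (rule r_into_rtrancl)
next
  case (step i)
  have "(Up i, Up (Suc i)) \<in> Z_edges n m" using step by (simp add: Z_edges_def)
  moreover have "(Up (Suc i), OneHat) \<in> (Z_edges n m)\<^sup>*" using step by simp
  ultimately show ?case by (rule converse_rtrancl_into_rtrancl)
qed

lemma Z_edges_Dn:
  assumes "1 \<le> i" "i \<le> m" shows "(Dn i, OneHat) \<in> (Z_edges n m)\<^sup>*"
  using assms(2,1)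
proof (induction rule: inc_induct)
  case base
  have "(Dn m, OneHat) \<in> Z_edges n m" by (simp add: Z_edges_def)
  then show ?case by (rule r_into_rtrancl)
next
  case (step i)
  have "(Dn i, Dn (Suc i)) \<in> Z_edges n m" using step by (simp add: Z_edges_def)
  moreover have "(Dn (Suc i), OneHat) \<in> (Z_edges n m)\<^sup>*" using step by simp
  ultimately show ?case by (rule converse_rtrancl_into_rtrancl)
qed

lemma bipath_edges_Up:
  assumes "1 \<le> i" "i \<le> j" "j \<le> n" shows "(Up i, Up j) \<in> (bipath_edges n m)\<^sup>*"
  using assms(2,3)
proof (induction rule: dec_induct)
  case (step j)
  have "(Up j, Up (Suc j)) \<in> bipath_edges n m"
    using step assms(1) by (simp add: bipath_edges_def)
  moreover have "(Up i, Up j) \<in> (bipath_edges n m)\<^sup>*" using step by simp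
  ultimately show ?case by (rule rtrancl_into_rtrancl[rotated])
qed simp

lemma bipath_edges_Dn:
  assumes "1 \<le> i" "i \<le> j" "j \<le> m" shows "(Dn i, Dn j) \<in> (bipath_edges n m)\<^sup>*"
  using assms(2,3)
proof (induction rule: dec_induct)
  case (step j)
  have "(Dn j, Dn (Suc j)) \<in> bipath_edges n m"
    using step assms(1) by (simp add: bipath_edges_def)
  moreover have "(Dn i, Dn j) \<in> (bipath_edges n m)\<^sup>*" using step by simp
  ultimately show ?case by (rule rtrancl_into_rtrancl[rotated])
qed simp

lemma Zposet_OneHat:
  assumes "n \<ge> 1" "m \<ge> 1" "x \<in> insert ZeroBar (bipath_set n m)"
  shows "(x, OneHat) \<in> Zposet n m"
proof -
  have "(ZeroBar, Up 1) \<in> Z_edges n m" "(ZeroHat, Dn 1) \<in> Z_edges n m"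
    by (simp_all add: Z_edges_def)
  from this[THEN converse_rtrancl_into_rtrancl]
  have "(ZeroBar, OneHat) \<in> (Z_edges n m)\<^sup>*" "(ZeroHat, OneHat) \<in> (Z_edges n m)\<^sup>*"
    using Z_edges_Up[of 1 n m] Z_edges_Dn[of 1 m n] assms by simp_all
  then have "(x, OneHat) \<in> (Z_edges n m)\<^sup>*"
    using assms(3) by (auto simp: bipath_set_def Z_edges_Up Z_edges_Dn)
  then show ?thesis using assms(3) by (auto simp: Zposet_eq bipath_set_def)
qed

lemma bipath_OneHat:
  assumes "n \<ge> 1" "m \<ge> 1" "x \<in> bipath_set n m"
  shows "(x, OneHat) \<in> bipath n m"
  using zeta_mono[OF Zposet_OneHat[OF assms(1,2)], of x] assms(3)
  by (simp add: zeta_bipath_set) (simp add: zeta_def)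

lemma bipath_ZeroHat:
  assumes "n \<ge> 1" "m \<ge> 1" "x \<in> bipath_set n m"
  shows "(ZeroHat, x) \<in> bipath n m"
proof -
  have edges: "(ZeroHat, Up 1) \<in> bipath_edges n m" "(ZeroHat, Dn 1) \<in> bipath_edges n m"
    by (simp_all add: bipath_edges_def)
  have up: "(ZeroHat, Up i) \<in> (bipath_edges n m)\<^sup>*" if "1 \<le> i" "i \<le> n" for i
    by (rule converse_rtrancl_into_rtrancl[OF edges(1) bipath_edges_Up[OF _ that]]) simp
  have dn: "(ZeroHat, Dn i) \<in> (bipath_edges n m)\<^sup>*" if "1 \<le> i" "i \<le> m" for i
    by (rule converse_rtrancl_into_rtrancl[OF edges(2) bipath_edges_Dn[OF _ that]]) simp
  have "ZeroHat \<in> bipath_set n m" by (simp add: bipath_set_def)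
  then show ?thesis
    using assms(3) up dn bipath_OneHat[OF assms(1,2), of ZeroHat]
    by (auto simp: bipath_set_def bipath_eq)
qed

section \<open>Comparison of the two multiplicities\<close>

text \<open>The naturality squares missing over \<open>Z\<close> are those from
  \<open>ZeroHat\<close> into the upper path. They are present with source \<open>ZeroBar\<close>,
  and can be used once the two components agree.\<close>

lemma nat_trans_descend:
  fixes A :: "(node, 'k::field, 'v::ab_group_add) kfunctor"
    and B :: "(node, 'k, 'w::ab_group_add) kfunctor"
  assumes \<phi>: "nat_trans (Zposet n m) (restriction zeta A) (restriction zeta B) \<phi>"
    and eq: "\<And>v. v \<in> obj A ZeroHat \<Longrightarrow> \<phi> ZeroBar v = \<phi> ZeroHat v"
  shows "nat_trans (bipath n m) A B \<phi>"
proof (rule nat_transI)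
  fix x and u v :: 'v and a :: 'k
  assume "x \<in> Field (bipath n m)"
  then have x: "x \<in> Field (Zposet n m)" "zeta x = x" by (simp_all add: zeta_bipath_set)
  assume v: "v \<in> obj A x"
  show "\<phi> x v \<in> obj B x" using nat_trans_in[OF \<phi> x(1)] x(2) v by simp
  show "\<phi> x (smul A a v) = smul B a (\<phi> x v)" using nat_trans_smul[OF \<phi> x(1)] x(2) v by simp
  assume u: "u \<in> obj A x"
  show "\<phi> x (u + v) = \<phi> x u + \<phi> x v" using nat_trans_add[OF \<phi> x(1)] x(2) u v by simp
next
  fix x y v and c :: 'k
  assume "x \<in> Field (bipath n m)" "y \<in> Field (bipath n m)"
  then have x: "x \<in> Field (Zposet n m)" "zeta x = x" and y: "y \<in> Field (Zposet n m)" "zeta y = y"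
    by (simp_all add: zeta_bipath_set)
  assume c: "c \<in> lin_hom (bipath n m) x y" and v: "v \<in> obj A x"
  show "\<phi> y (mor A x y c v) = mor B x y c (\<phi> x v)"
  proof (cases "c \<in> lin_hom (Zposet n m) x y")
    case True
    then show ?thesis using nat_trans_mor[OF \<phi> x(1) y(1)] x(2) y(2) v by simp
  next
    case False
    then have "(x, y) \<in> bipath n m" "(x, y) \<notin> Zposet n m" using c by (auto simp: lin_hom_def)
    then have Z: "x = ZeroHat" "(ZeroBar, y) \<in> Zposet n m"
      using bipath_imp_Zposet bipath_from_ZeroHat by blast+
    have "\<phi> y (mor (restriction zeta A) ZeroBar y c v) =
        mor (restriction zeta B) ZeroBar y c (\<phi> ZeroBar v)"
      by (rule nat_trans_mor[OF \<phi> _ y(1)]) (use Z v in \<open>auto simp: lin_hom_def zeta_def\<close>)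
    then show ?thesis using eq v Z(1) y(2) by (simp add: zeta_def[of ZeroBar])
  qed
qed

text \<open>The last assumption excludes intervals that contain \<open>ZeroHat\<close> but stop
  before \<open>OneHat\<close>. The preimage of such an interval contains both minimal elements of
  \<open>Z\<close>, whose only common upper bound is \<open>OneHat\<close>, so it has no greatest
  element.\<close>

locale bipath_interval =
  fixes n m :: nat and I :: "node set" and x0 :: node
  assumes n: "n \<ge> 1" and m: "m \<ge> 1"
    and I: "I \<subseteq> bipath_set n m" and x0: "x0 \<in> I"
    and top: "x \<in> I \<Longrightarrow> (x, x0) \<in> bipath n m"
    and convex: "x \<in> I \<Longrightarrow> z \<in> I \<Longrightarrow> (x, y) \<in> bipath n m \<Longrightarrow> (y, z) \<in> bipath n m \<Longrightarrow> y \<in> I"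
    and ZeroHat: "ZeroHat \<notin> I \<or> I = bipath_set n m \<and> x0 = OneHat"
begin

lemma zeta_x0: "zeta x0 = x0"
  using I x0 zeta_bipath_set by blast

lemma brick_bipath: "brick (bipath n m) (interval_module I) x0"
proof (rule brick_interval_module)
  show "y \<in> I" if "x \<in> I" "z \<in> I" "(x, y) \<in> bipath n m" "(y, z) \<in> bipath n m" for x y z
    using that by (rule convex)
  show "(x, x0) \<in> bipath n m" if "x \<in> I" for x
    using that by (rule top)
  show "I \<subseteq> Field (bipath n m)" using I by simp
  show "finite (Field (bipath n m))" using finite_bipath_set by simp
qed (rule x0)

lemma brick_Zposet: "brick (Zposet n m) (restriction zeta (interval_module I)) x0"
  unfolding restriction_interval_module
proof (rule brick_interval_module)
  show "zeta -` I \<subseteq> Field (Zposet n m)" using I by (auto simp: zeta_def split: if_splits)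
  show "(x, x0) \<in> Zposet n m" if "x \<in> zeta -` I" for x
    using ZeroHat
  proof
    assume "ZeroHat \<notin> I"
    then have "zeta x = x" "x \<noteq> ZeroHat" using that by (auto simp: zeta_def split: if_splits)
    then show ?thesis using bipath_imp_Zposet[OF top] that by auto
  next
    assume "I = bipath_set n m \<and> x0 = OneHat"
    moreover have "x \<in> insert ZeroBar (bipath_set n m)"
      using that I by (auto simp: zeta_def split: if_splits)
    ultimately show ?thesis using Zposet_OneHat[OF n m] by blast
  qed
  show "y \<in> zeta -` I" if "x \<in> zeta -` I" "z \<in> zeta -` I" "(x, y) \<in> Zposet n m" "(y, z) \<in> Zposet n m" for x y z
    using convex[OF _ _ zeta_mono[OF that(3)] zeta_mono[OF that(4)]] that(1,2) by simp
  show "finite (Field (Zposet n m))" using finite_bipath_set by simp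
  show "x0 \<in> zeta -` I" using x0 zeta_x0 by simp
qed

lemma kmodule_restriction_zeta:
  "kmodule (bipath n m) M \<Longrightarrow> kmodule (Zposet n m) (restriction zeta M)"
  by (rule kmodule_restriction) (use zeta_in zeta_mono in auto)

lemma nat_trans_restriction_zeta:
  "nat_trans (bipath n m) A B \<phi> \<Longrightarrow>
    nat_trans (Zposet n m) (restriction zeta A) (restriction zeta B) (\<lambda>x. \<phi> (zeta x))"
  by (rule nat_trans_restriction) (use zeta_in zeta_mono in auto)

text \<open>In this direction the given morphism itself descends: its components at
  \<open>ZeroBar\<close> and \<open>ZeroHat\<close> are both zero, or both determined by the
  component at \<open>OneHat\<close>.\<close>

lemma hom_functionals_restriction:
  fixes M :: "(node, 'k::field, 'v::ab_group_add) kfunctor"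
  shows "hom_functionals (Zposet n m) (restriction zeta (interval_module I)) x0 (restriction zeta M) =
    hom_functionals (bipath n m) (interval_module I) x0 M"
    (is "hom_functionals _ ?RV x0 ?RM = _")
proof (intro set_eqI iffI)
  fix \<delta> assume "\<delta> \<in> hom_functionals (bipath n m) (interval_module I) x0 M"
  then obtain g where g: "nat_trans (bipath n m) M (interval_module I) g" "\<delta> = g x0"
    unfolding hom_functionals_def by blast
  then show "\<delta> \<in> hom_functionals (Zposet n m) ?RV x0 ?RM"
    by (intro hom_functionalsI[OF nat_trans_restriction_zeta[OF g(1)]]) (simp add: zeta_x0)
next
  fix \<delta> assume "\<delta> \<in> hom_functionals (Zposet n m) ?RV x0 ?RM"
  then obtain g where g: "nat_trans (Zposet n m) ?RM ?RV g" and \<delta>: "\<delta> = g x0"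
    unfolding hom_functionals_def by blast
  have "g ZeroBar v = g ZeroHat v" if v: "v \<in> obj M ZeroHat" for v
    using ZeroHat
  proof
    assume "ZeroHat \<notin> I"
    then show ?thesis
      using nat_trans_in[OF g, of ZeroBar v] nat_trans_in[OF g, of ZeroHat v] v
      by (simp add: zeta_def bipath_set_def)
  next
    assume "I = bipath_set n m \<and> x0 = OneHat"
    then have V: "ZeroHat \<in> I" "OneHat \<in> I" by (simp_all add: bipath_set_def)
    \<comment> \<open>The interval module has identity structure maps up to \<open>OneHat\<close>,
      and the left side does not depend on which preimage \<open>z\<close> is taken.\<close>
    have *: "g OneHat (mor M ZeroHat OneHat 1 v) = g z v" if "zeta z = ZeroHat" "z \<in> Field (Zposet n m)" for z
      using nat_trans_mor[OF g that(2), of OneHat 1 v] Zposet_OneHat[OF n m, of z] V v that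
      by (simp add: lin_hom_def bipath_set_def) (simp add: zeta_def)
    show ?thesis using *[of ZeroBar] *[of ZeroHat] by (simp add: zeta_def bipath_set_def)
  qed
  then have "nat_trans (bipath n m) M (interval_module I) g" by (rule nat_trans_descend[OF g])
  then show "\<delta> \<in> hom_functionals (bipath n m) (interval_module I) x0 M" using \<delta> by (rule hom_functionalsI)
qed

text \<open>
  If \<open>I\<close> is the whole poset, a morphism \<open>f\<close> from the restricted interval module may take different
  values at the two minimal elements of \<open>Zposet n m\<close>, so it need not descend. Extending its value at
  \<open>ZeroHat\<close> along the structure maps of \<open>M\<close> gives a morphism over \<open>bipath n m\<close> that still has the
  same value at \<open>OneHat\<close>.
\<close>

lemma hom_values_restriction:
  fixes M :: "(node, 'k::field, 'v::ab_group_add) kfunctor"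
  assumes M: "kmodule (bipath n m) M"
  shows "hom_values (Zposet n m) (restriction zeta (interval_module I)) x0 (restriction zeta M) =
    hom_values (bipath n m) (interval_module I) x0 M"
    (is "hom_values _ ?RV x0 ?RM = _")
proof (intro set_eqI iffI)
  fix v assume "v \<in> hom_values (bipath n m) (interval_module I) x0 M"
  then obtain f where f: "nat_trans (bipath n m) (interval_module I) M f" "v = f x0 1"
    unfolding hom_values_def by blast
  then show "v \<in> hom_values (Zposet n m) ?RV x0 ?RM"
    by (intro hom_valuesI[OF nat_trans_restriction_zeta[OF f(1)]]) (simp add: zeta_x0)
next
  fix u assume "u \<in> hom_values (Zposet n m) ?RV x0 ?RM"
  then obtain f where f: "nat_trans (Zposet n m) ?RV ?RM f" and u: "u = f x0 1"
    unfolding hom_values_def by blast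
  show "u \<in> hom_values (bipath n m) (interval_module I) x0 M"
    using ZeroHat
  proof
    assume "ZeroHat \<notin> I"
    \<comment> \<open>The source vanishes at \<open>ZeroHat\<close>, so both components are only
      evaluated at zero.\<close>
    then have "f ZeroBar v = f ZeroHat v" if "v \<in> obj (interval_module I) ZeroHat" for v
      using nat_trans_zero[OF f, of ZeroBar] nat_trans_zero[OF f, of ZeroHat] that
      by (simp add: zeta_def bipath_set_def)
    then have "nat_trans (bipath n m) (interval_module I) M f" by (rule nat_trans_descend[OF f])
    then show ?thesis using u by (rule hom_valuesI)
  next
    assume full: "I = bipath_set n m \<and> x0 = OneHat"
    have 0: "ZeroHat \<in> bipath_set n m" "OneHat \<in> bipath_set n m" by (simp_all add: bipath_set_def)
    have fH: "f ZeroHat v \<in> obj M ZeroHat" "f ZeroHat (v + w) = f ZeroHat v + f ZeroHat w"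
      "f ZeroHat (a * v) = smul M a (f ZeroHat v)" for v w a
      using nat_trans_in[OF f, of ZeroHat v] nat_trans_add[OF f, of ZeroHat v w]
        nat_trans_smul[OF f, of ZeroHat v a] 0 full by (simp_all add: zeta_def)
    have one: "1 \<in> lin_hom (bipath n m) ZeroHat x" if "x \<in> bipath_set n m" for x
      using bipath_ZeroHat[OF n m that] by (simp add: lin_hom_def)
    have "nat_trans (bipath n m) (interval_module I) M (\<lambda>x v. mor M ZeroHat x 1 (f ZeroHat v))"
    proof (rule nat_transI)
      fix x and v w a :: 'k assume "x \<in> Field (bipath n m)"
      then have x: "x \<in> bipath_set n m" by simp
      show "mor M ZeroHat x 1 (f ZeroHat v) \<in> obj M x"
        by (rule kmodule_mor_in[OF M]) (use 0 x one fH in auto)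
      show "mor M ZeroHat x 1 (f ZeroHat (v + w)) =
          mor M ZeroHat x 1 (f ZeroHat v) + mor M ZeroHat x 1 (f ZeroHat w)"
        unfolding fH(2) by (rule kmodule_mor_add[OF M]) (use 0 x one fH in auto)
      show "mor M ZeroHat x 1 (f ZeroHat (smul (interval_module I) a v)) =
          smul M a (mor M ZeroHat x 1 (f ZeroHat v))"
        unfolding interval_module_simps fH(3)
        by (rule kmodule_mor_smul[OF M]) (use 0 x one fH in auto)
    next
      fix x y and c v :: 'k
      assume "x \<in> Field (bipath n m)" "y \<in> Field (bipath n m)" and c: "c \<in> lin_hom (bipath n m) x y"
      then have x: "x \<in> bipath_set n m" and y: "y \<in> bipath_set n m" by simp_all
      have "mor M x y c (mor M ZeroHat x 1 (f ZeroHat v)) = mor M ZeroHat y (c * 1) (f ZeroHat v)"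
        by (rule kmodule_mor_comp[OF M]) (use 0 x y one fH c in auto)
      also have "\<dots> = smul M c (mor M ZeroHat y 1 (f ZeroHat v))"
        by (rule kmodule_mor_scalar[OF M]) (use 0 y one fH in auto)
      also have "\<dots> = mor M ZeroHat y 1 (smul M c (f ZeroHat v))"
        by (rule kmodule_mor_smul[OF M, symmetric]) (use 0 y one fH in auto)
      finally show "mor M ZeroHat y 1 (f ZeroHat (mor (interval_module I) x y c v)) =
          mor M x y c (mor M ZeroHat x 1 (f ZeroHat v))"
        using full x y by (simp add: fH(3))
    qed
    \<comment> \<open>The arrow from \<open>ZeroHat\<close> to \<open>OneHat\<close> survives in
      \<open>Zposet n m\<close> along the lower path, so naturality of \<open>f\<close> computes its
      value at \<open>OneHat\<close>.\<close>
    moreover have "u = mor M ZeroHat x0 1 (f ZeroHat 1)"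
      using nat_trans_mor[OF f, of ZeroHat OneHat 1 1] Zposet_OneHat[OF n m, of ZeroHat] 0 full u
      by (simp add: lin_hom_def zeta_def)
    ultimately show ?thesis by (rule hom_valuesI)
  qed
qed

lemma multiplicities_eq:
  fixes M :: "(node, 'k::field, 'v::ab_group_add) kfunctor"
  assumes M: "kmodule (bipath n m) M"
  shows "mult (bipath n m) M (interval_module I)
      = mult_bar (Zposet n m) (restriction zeta M) (restriction zeta (interval_module I)) \<and>
    mult_bar (Zposet n m) (restriction zeta M) (restriction zeta (interval_module I))
      = mult (Zposet n m) (restriction zeta M) (restriction zeta (interval_module I))"
proof -
  obtain S :: "nat set" and u \<gamma> where S: "dual_basis (hom_values (bipath n m) (interval_module I) x0 M)
      (hom_functionals (bipath n m) (interval_module I) x0 M) S u \<gamma>"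
    using brick.exists_dual_basis[OF brick_bipath M] by blast
  \<comment> \<open>The sets of values and functionals coincide literally, so the same dual basis
    serves over both posets.\<close>
  note S' = S[folded hom_values_restriction[OF M] hom_functionals_restriction]
  show ?thesis
    using brick.mult_eq_card[OF brick_bipath M S]
      brick.mult_eq_card[OF brick_Zposet kmodule_restriction_zeta[OF M] S']
      brick.mult_bar_eq_card[OF brick_Zposet kmodule_restriction_zeta[OF M] S'] by simp
qed

end

section \<open>The families of intervals in the statement\<close>

lemma segment_bipath_convex:
  assumes "x \<in> segment (bipath n m) s t" "(x, y) \<in> bipath n m" "(y, t) \<in> bipath n m"
  shows "y \<in> segment (bipath n m) s t"
  using assms bipath_trans[of s x n m y] bipath_in[OF assms(2)] by (simp add: segment_def)

theorem proposition6p6: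
  fixes n m :: nat
    and I :: "node set"
    and M :: "(node, 'k::field, 'v::ab_group_add) kfunctor"
  assumes "n \<ge> 1" and "m \<ge> 1"
    and "I \<in> intervals_d n m \<union> intervals_u n m \<union> intervals_r n m \<union> {bipath_set n m}"
    and "kmodule (bipath n m) M"
  shows "mult (bipath n m) M (interval_module I)
           = mult_bar (Zposet n m) (restriction zeta M) (restriction zeta (interval_module I)) \<and>
         mult_bar (Zposet n m) (restriction zeta M) (restriction zeta (interval_module I))
           = mult (Zposet n m) (restriction zeta M) (restriction zeta (interval_module I))"
proof -
  note mult_eq = bipath_interval.multiplicities_eq[OF bipath_interval.intro[OF assms(1,2)] assms(4)]
  note top = bipath_OneHat[OF assms(1,2)]
  \<comment> \<open>Upper and lower segments are treated alike: \<open>t\<close> is the greatest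
    element, and \<open>ZeroHat\<close> is avoided because nothing else lies below it.\<close>
  have seg: ?thesis if I: "I = segment (bipath n m) s t" and st: "(s, t) \<in> bipath n m" "s \<noteq> ZeroHat"
    for s t
  proof (rule mult_eq[of I t])
    show "t \<in> I" using st(1) bipath_in[OF st(1)] by (auto simp: I segment_def bipath_refl)
    show "y \<in> I" if "x \<in> I" "z \<in> I" "(x, y) \<in> bipath n m" "(y, z) \<in> bipath n m" for x y z
    proof -
      have "(z, t) \<in> bipath n m" using that(2) by (simp add: I segment_def)
      then show ?thesis
        using that segment_bipath_convex[of x n m s t y] bipath_trans[OF that(4)] by (simp add: I)
    qed
    show "ZeroHat \<notin> I \<or> I = bipath_set n m \<and> t = OneHat"
      using st(2) bipath_to_ZeroHat[of s n m] by (auto simp: I segment_def)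
    show "I \<subseteq> bipath_set n m" by (auto simp: I segment_def)
    show "(x, t) \<in> bipath n m" if "x \<in> I" for x using that by (simp add: I segment_def)
  qed
  from assms(3) consider "I \<in> intervals_d n m \<union> intervals_u n m" | "I \<in> intervals_r n m" | "I = bipath_set n m"
    by blast
  then show ?thesis
  proof cases
    case 1
    have up: "(Up s, Up t) \<in> bipath n m" if "1 \<le> s" "s \<le> t" "t \<le> n" for s t
      using bipath_edges_Up[OF that] that by (auto simp: bipath_eq bipath_set_def)
    have dn: "(Dn s, Dn t) \<in> bipath n m" if "1 \<le> s" "s \<le> t" "t \<le> m" for s t
      using bipath_edges_Dn[OF that] that by (auto simp: bipath_eq bipath_set_def)
    from 1 show ?thesis
    proof
      assume "I \<in> intervals_d n m"
      then obtain s t where "I = segment (bipath n m) (Dn s) (Dn t)" "1 \<le> s" "s \<le> t" "t \<le> m"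
        unfolding intervals_d_def by blast
      then show ?thesis by (intro seg[OF _ dn]) simp_all
    next
      assume "I \<in> intervals_u n m"
      then obtain s t where "I = segment (bipath n m) (Up s) (Up t)" "1 \<le> s" "s \<le> t" "t \<le> n"
        unfolding intervals_u_def by blast
      then show ?thesis by (intro seg[OF _ up]) simp_all
    qed
  next
    case 2
    then obtain s s' where s: "s \<in> insert OneHat (Up ` {1..n})" and s': "s' \<in> insert OneHat (Dn ` {1..m})"
      and I: "I = segment (bipath n m) s OneHat \<union> segment (bipath n m) s' OneHat"
      unfolding intervals_r_def by blast
    have sP: "s \<in> bipath_set n m" using s by (auto simp: bipath_set_def)
    show ?thesis
    proof (rule mult_eq[of I OneHat])
      show "OneHat \<in> I"
        using top[OF sP] bipath_in[OF top[OF sP]] by (simp add: I segment_def bipath_refl)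
      show "y \<in> I" if "x \<in> I" "z \<in> I" "(x, y) \<in> bipath n m" "(y, z) \<in> bipath n m" for x y z
      proof -
        \<comment> \<open>Both segments are upward closed, so \<open>y\<close> stays in whichever of
          them contains \<open>x\<close>; the position of \<open>z\<close> does not have to be
          distinguished.\<close>
        have "(y, OneHat) \<in> bipath n m" using top bipath_in[OF that(3)] by blast
        then show ?thesis
          using that(1) segment_bipath_convex[OF _ that(3)] unfolding I by blast
      qed
      have "s \<noteq> ZeroHat" "s' \<noteq> ZeroHat" using s s' by auto
      then show "ZeroHat \<notin> I \<or> I = bipath_set n m \<and> OneHat = OneHat"
        using bipath_to_ZeroHat[of s n m] bipath_to_ZeroHat[of s' n m]
        by (auto simp: I segment_def)
      show "I \<subseteq> bipath_set n m" by (auto simp: I segment_def)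
      show "(x, OneHat) \<in> bipath n m" if "x \<in> I" for x using that by (auto simp: I segment_def)
    qed
  next
    case 3
    show ?thesis
    proof (rule mult_eq[of I OneHat])
      show "OneHat \<in> I" using 3 by (simp add: bipath_set_def)
      show "y \<in> I" if "x \<in> I" "z \<in> I" "(x, y) \<in> bipath n m" "(y, z) \<in> bipath n m" for x y z
        using bipath_in[OF that(3)] unfolding 3 by blast
      show "(x, OneHat) \<in> bipath n m" if "x \<in> I" for x using that unfolding 3 by (rule top)
    qed (simp_all add: 3)
  qed
qed

end
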